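(* Let $n\ge2$ be an integer which is not of the form $2^{k}$ for any positive integer $k$. Let $0<r<\frac12$, let $P$ be the Cantor distribution with parameter $r$, and let $\beta_n(I)$ and $\gamma_n(I')$ be the sets defined in the context for arbitrary admissible index sets $I$ and $I'$. Then $$V(P,\beta_n(I))>V(P,\gamma_n(I'))\quad\text{if } r_0<r\le r_+<\tfrac{5-\sqrt{17}}{2},$$ and $$V(P,\beta_n(I))=V(P,\gamma_n(I'))\quad\text{if } r=r_0,$$ where $r_0\approx0.4350411707$ and $r_+\approx0.4376259168$.
   Context: Let $r_0\approx 0.4350411707$ be the unique real number $r\in(0,\frac12)$ with $(r-1)(r^4+r^2)=\frac16\left(r^7+r^6+4r^5-2r^4-2r^3-8r^2+9r-3\right)$, and let $r_+\approx0.4376259168$ be the unique root in $(0,\frac12)$ of $11r^3-12r^2+10r-3=0$. For $0<r<\frac12$ let $S_1(x)=rx$ and $S_2(x)=rx+1-r$ on $\mathbb R$, and let $P$ (the Cantor distribution with parameter $r$) be the unique Borel probability measure on $\mathbb R$ with $P=\frac12 P\circ S_1^{-1}+\frac12 P\circ S_2^{-1}$. For a word $\sigma=\sigma_1\cdots\sigma_k\in\{1,2\}^k$ put $S_\sigma=S_{\sigma_1}\circ\cdots\circ S_{\sigma_k}$ and $J_\sigma=S_\sigma([0,1])$; $\sigma\tau$ denotes concatenation. Let $X$ be a random variable with distribution $P$; for words $\beta,\dots,\delta$ put $a(\beta,\dots,\delta)=E(X\mid X\in J_\beta\cup\cdots\cup J_\delta)$; in particular $a(\sigma)=S_\sigma(\frac12)$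 is the midpoint of $J_\sigma$. For finite $\alpha\subset\mathbb R$, $V(P,\alpha)=\int\min_{a\in\alpha}(x-a)^2\,dP(x)$ is the distortion error. For $n\ge 2$ let $\ell(n)$ be the unique natural number with $2^{\ell(n)}\le n<2^{\ell(n)+1}$. The sets $\beta_n(I)$: for $I\subset\{1,2\}^{\ell(n)}$ with $\mathrm{card}(I)=n-2^{\ell(n)}$, $$\beta_n(I)=\{a(\sigma):\sigma\in\{1,2\}^{\ell(n)}\setminus I\}\cup\{a(\sigma1):\sigma\in I\}\cup\{a(\sigma2):\sigma\in I\}.$$ The sets $\gamma_n(I)$: $\gamma_2=\{a(1),a(2)\}$ and $\gamma_3=\{a(11,121),a(122,211),a(212,22)\}$ (no index set needed). For $n\ge4$: if $2^{\ell(n)}\le n\le 3\cdot2^{\ell(n)-1}$, for $I\subset\{1,2\}^{\ell(n)-1}$ with $\mathrm{card}(I)=n-2^{\ell(n)}$, $$\gamma_n(I)=\bigcup_{\omega\in I}S_\omega(\gamma_3)\cup\bigcup_{\omega\in\{1,2\}^{\ell(n)-1}\setminus I}S_\omega(\gamma_2);$$ if $3\cdot2^{\ell(n)-1}<n<2^{\ell(n)+1}$, for $I\subset\{1,2\}^{\ell(n)-1}$ with $\mathrm{card}(I)=n-3\cdot2^{\ell(n)-1}$, $$\gamma_n(I)=\bigcup_{\omega\in\{1,2\}^{\ell(n)-1}\setminus I}S_\omega(\gamma_3)\cup\bigcup_{\omega\in I}S_\omega(\gamma_4),$$ where $\gamma_4=\{a(11),a(12),a(21),a(22)\}$ (the case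 $n=4$, $I=\emptyset$). *)

theory Defs
  imports "HOL-Probability.Probability"
begin

definition r0_equation :: "real \<Rightarrow> bool" where
  "r0_equation r \<longleftrightarrow>
     (r - 1) * (r^4 + r^2) =
       1/6 * (r^7 + r^6 + 4 * r^5 - 2 * r^4 - 2 * r^3 - 8 * r^2 + 9 * r - 3)"

definition r_zero :: real where
  "r_zero = (THE r. 0 < r \<and> r < 1/2 \<and> r0_equation r)"

definition r_plus :: real where
  "r_plus = (THE r. 0 < r \<and> r < 1/2 \<and> 11 * r^3 - 12 * r^2 + 10 * r - 3 = 0)"

text \<open>
  Words over \<open>{1, 2}\<close> are lists of natural numbers. Only the letters 1 and 2 are ever used;
  \<open>sim r i\<close> is \<open>S\<^sub>i\<close> for these.
\<close>

definition sim :: "real \<Rightarrow> nat \<Rightarrow> real \<Rightarrow> real" where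
  "sim r i x = (if i = 1 then r * x else r * x + 1 - r)"

definition words :: "nat \<Rightarrow> nat list set" where
  "words k = {w. set w \<subseteq> {1, 2} \<and> length w = k}"

fun sim_word :: "real \<Rightarrow> nat list \<Rightarrow> real \<Rightarrow> real" where
  "sim_word r [] x = x"
| "sim_word r (i # w) x = sim r i (sim_word r w x)"

definition J :: "real \<Rightarrow> nat list \<Rightarrow> real set" where
  "J r w = sim_word r w ` {0..1}"

definition cantor_distribution :: "real \<Rightarrow> real measure \<Rightarrow> bool" where
  "cantor_distribution r P \<longleftrightarrow>
     prob_space P \<and> sets P = sets borel \<and>
     (\<forall>A \<in> sets borel. measure P A =
        1/2 * measure (distr P borel (sim r 1)) A + 1/2 * measure (distr P borel (sim r 2)) A)"

text \<open>
  \<open>cmean r P {\<beta>, \<dots>, \<delta>}\<close> is \<open>a(\<beta>, \<dots>, \<delta>) = E(X | X \<in> J\<^sub>\<beta> \<union> \<dots> \<union> J\<^sub>\<delta>)\<close>, the expectation of \<open>X\<close>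
  conditional on an event.
\<close>

definition cmean :: "real \<Rightarrow> real measure \<Rightarrow> nat list set \<Rightarrow> real" where
  "cmean r P W = (LINT x : (\<Union>w\<in>W. J r w) | P. x) / measure P (\<Union>w\<in>W. J r w)"

definition distortion :: "real measure \<Rightarrow> real set \<Rightarrow> real" where
  "distortion P \<alpha> = (LINT x | P. (MIN a\<in>\<alpha>. (x - a)^2))"

definition ell :: "nat \<Rightarrow> nat" where
  "ell n = (THE l. 2 ^ l \<le> n \<and> n < 2 ^ (l + 1))"

definition beta_index :: "nat \<Rightarrow> nat list set \<Rightarrow> bool" where
  "beta_index n I \<longleftrightarrow> I \<subseteq> words (ell n) \<and> card I = n - 2 ^ ell n"

definition beta_set :: "real \<Rightarrow> real measure \<Rightarrow> nat \<Rightarrow> nat list set \<Rightarrow> real set" where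
  "beta_set r P n I =
     {cmean r P {\<sigma>} | \<sigma>. \<sigma> \<in> words (ell n) - I}
     \<union> {cmean r P {\<sigma> @ [1]} | \<sigma>. \<sigma> \<in> I}
     \<union> {cmean r P {\<sigma> @ [2]} | \<sigma>. \<sigma> \<in> I}"

definition gamma_two :: "real \<Rightarrow> real measure \<Rightarrow> real set" where
  "gamma_two r P = {cmean r P {[1]}, cmean r P {[2]}}"

definition gamma_three :: "real \<Rightarrow> real measure \<Rightarrow> real set" where
  "gamma_three r P =
     {cmean r P {[1,1], [1,2,1]}, cmean r P {[1,2,2], [2,1,1]}, cmean r P {[2,1,2], [2,2]}}"

definition gamma_four :: "real \<Rightarrow> real measure \<Rightarrow> real set" where
  "gamma_four r P =
     {cmean r P {[1,1]}, cmean r P {[1,2]}, cmean r P {[2,1]}, cmean r P {[2,2]}}"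

text \<open>
  For \<open>n < 4\<close> there is no index set; \<open>{}\<close> serves as a dummy, which \<open>gamma_set\<close> ignores.
\<close>

definition gamma_index :: "nat \<Rightarrow> nat list set \<Rightarrow> bool" where
  "gamma_index n I \<longleftrightarrow>
     (if n < 4 then I = {}
      else I \<subseteq> words (ell n - 1) \<and>
           card I = (if n \<le> 3 * 2 ^ (ell n - 1) then n - 2 ^ ell n else n - 3 * 2 ^ (ell n - 1)))"

definition gamma_set :: "real \<Rightarrow> real measure \<Rightarrow> nat \<Rightarrow> nat list set \<Rightarrow> real set" where
  "gamma_set r P n I =
     (if n = 2 then gamma_two r P
      else if n = 3 then gamma_three r P
      else if n \<le> 3 * 2 ^ (ell n - 1) then
        (\<Union>\<omega>\<in>I. sim_word r \<omega> ` gamma_three r P)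
        \<union> (\<Union>\<omega>\<in>words (ell n - 1) - I. sim_word r \<omega> ` gamma_two r P)
      else
        (\<Union>\<omega>\<in>words (ell n - 1) - I. sim_word r \<omega> ` gamma_three r P)
        \<union> (\<Union>\<omega>\<in>I. sim_word r \<omega> ` gamma_four r P))"

text \<open>The definite descriptions \<open>r_zero\<close> and \<open>r_plus\<close> are well defined, and located as expected.\<close>

lemma unique_root_unit_half:
  fixes f :: "real \<Rightarrow> real"
  assumes cont: "continuous_on {0..1/2} f"
    and mono: "\<And>x y. 0 < x \<Longrightarrow> x < y \<Longrightarrow> y < 1/2 \<Longrightarrow> f x < f y"
    and ab: "0 < a" "a < b" "b < 1/2" and sgn: "f a < 0" "0 < f b"
  shows "\<exists>!r. 0 < r \<and> r < 1/2 \<and> f r = 0"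
    and "(THE r. 0 < r \<and> r < 1/2 \<and> f r = 0) \<in> {a<..<b}"
proof -
  have "continuous_on {a..b} f"
    using ab by (intro continuous_on_subset[OF cont]) auto
  then obtain c where c: "a \<le> c" "c \<le> b" "f c = 0"
    using IVT'[of f a 0 b] ab sgn by auto
  have c': "0 < c \<and> c < 1/2 \<and> f c = 0" using c ab by auto
  have uniq: "r = c" if "0 < r \<and> r < 1/2 \<and> f r = 0" for r
    using mono[of r c] mono[of c r] that c' by (cases r c rule: linorder_cases) auto
  show "\<exists>!r. 0 < r \<and> r < 1/2 \<and> f r = 0" using c' uniq by blast
  have "(THE r. 0 < r \<and> r < 1/2 \<and> f r = 0) = c"
    by (rule the_equality[OF _ uniq]) (use c' in simp_all)
  moreover have "c \<noteq> a" "c \<noteq> b" using c sgn by auto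
  ultimately show "(THE r. 0 < r \<and> r < 1/2 \<and> f r = 0) \<in> {a<..<b}" using c by auto
qed

lemma r_zero:
  shows r_zero_unique: "\<exists>!r. 0 < r \<and> r < 1/2 \<and> r0_equation r"
    and r_zero_approx: "\<bar>r_zero - 0.4350411707\<bar> < 1 / 10^10"
proof -
  define f :: "real \<Rightarrow> real" where
    "f r = r^7 + r^6 - 2 * r^5 + 4 * r^4 - 8 * r^3 - 2 * r^2 + 9 * r - 3" for r
  have eq: "r0_equation r \<longleftrightarrow> f r = 0" for r
  proof -
    have "(r - 1) * (r^4 + r^2)
        - 1/6 * (r^7 + r^6 + 4 * r^5 - 2 * r^4 - 2 * r^3 - 8 * r^2 + 9 * r - 3) = - f r / 6"
      unfolding f_def by (simp add: algebra_simps eval_nat_numeral)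
    then show ?thesis unfolding r0_equation_def by linarith
  qed
  have cont: "continuous_on {0..1/2} f"
    unfolding f_def by (intro continuous_intros)
  have mono: "f x < f y" if "0 < x" "x < y" "y < 1/2" for x y
  proof (rule DERIV_pos_imp_increasing[OF that(2)])
    fix t assume t: "x \<le> t" "t \<le> y"
    have t': "0 < t" "t < 1/2" using t that by auto
    have d: "(f has_real_derivative
        7 * t^6 + 6 * t^5 - 10 * t^4 + 16 * t^3 - 24 * t^2 - 4 * t + 9) (at t)"
      unfolding f_def by (auto intro!: derivative_eq_intros)
    have "t * t < 1/2 * (1/2)" by (intro mult_strict_mono) (use t' in auto)
    then have 1: "24 * t^2 + 4 * t < 9" using t' by (simp add: power2_eq_square)
    have "0 < t^3 * (16 - 10 * t)" using t' by auto
    then have 2: "0 < 16 * t^3 - 10 * t^4" by (simp add: algebra_simps eval_nat_numeral)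
    have 3: "0 < t^6" "0 < t^5" using t' by auto
    show "\<exists>D. (f has_real_derivative D) (at t) \<and> 0 < D"
      using 1 2 3 by (intro exI[of _ "7 * t^6 + 6 * t^5 - 10 * t^4 + 16 * t^3 - 24 * t^2 - 4 * t + 9"]
          conjI d) linarith
  qed
  have s: "f 0.4350411706 < 0" "0 < f 0.4350411708"
    unfolding f_def by (simp_all add: power_divide)
  show "\<exists>!r. 0 < r \<and> r < 1/2 \<and> r0_equation r"
    unfolding eq by (rule unique_root_unit_half(1)[OF cont mono _ _ _ s]) auto
  have "r_zero \<in> {0.4350411706<..<0.4350411708}"
    unfolding r_zero_def eq by (rule unique_root_unit_half(2)[OF cont mono _ _ _ s]) auto
  then show "\<bar>r_zero - 0.4350411707\<bar> < 1 / 10^10" unfolding abs_less_iff by simp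
qed

lemma r_plus:
  shows r_plus_unique: "\<exists>!r::real. 0 < r \<and> r < 1/2 \<and> 11 * r^3 - 12 * r^2 + 10 * r - 3 = 0"
    and r_plus_approx: "\<bar>r_plus - 0.4376259168\<bar> < 1 / 10^10"
proof -
  define f :: "real \<Rightarrow> real" where "f r = 11 * r^3 - 12 * r^2 + 10 * r - 3" for r
  have cont: "continuous_on {0..1/2} f"
    unfolding f_def by (intro continuous_intros)
  have mono: "f x < f y" if "0 < x" "x < y" "y < 1/2" for x y
  proof (rule DERIV_pos_imp_increasing[OF that(2)])
    fix t :: real
    have d: "(f has_real_derivative 33 * t^2 - 24 * t + 10) (at t)"
      unfolding f_def by (auto intro!: derivative_eq_intros)
    have "33 * t^2 - 24 * t + 10 = 33 * (t - 4/11)^2 + 62/11"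
      by (simp add: power2_eq_square algebra_simps)
    also have "\<dots> > 0" by (intro add_nonneg_pos) auto
    finally show "\<exists>D. (f has_real_derivative D) (at t) \<and> 0 < D" using d by blast
  qed
  have s: "f 0.4376259167 < 0" "0 < f 0.4376259169"
    unfolding f_def by (simp_all add: field_simps)
  show "\<exists>!r::real. 0 < r \<and> r < 1/2 \<and> 11 * r^3 - 12 * r^2 + 10 * r - 3 = 0"
    unfolding f_def[symmetric] by (rule unique_root_unit_half(1)[OF cont mono _ _ _ s]) auto
  have "r_plus \<in> {0.4376259167<..<0.4376259169}"
    unfolding r_plus_def f_def[symmetric]
    by (rule unique_root_unit_half(2)[OF cont mono _ _ _ s]) auto
  then show "\<bar>r_plus - 0.4376259168\<bar> < 1 / 10^10" unfolding abs_less_iff by simp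
qed

end

theory Submission
  imports Defs
begin

text \<open>
  Both families of point sets are built by putting small point sets into the cylinders of one level: for
  \<open>beta_set\<close>, the cylinders of level \<open>ell n\<close> receive their midpoint or, if the word is
  in the index set, a copy of the pair of midpoints of its two subcylinders; for \<open>gamma_set\<close>, the
  cylinders of level \<open>ell n - 1\<close> receive copies of the two-point, three-point or four-point set. In
  the relevant range of \<open>r\<close> the holes between cylinders are so large that every point of the Cantor
  set is nearest to a point in its own cylinder (\<open>gap\<close> and \<open>distortion_tiling\<close>). By
  self-similarity (\<open>integral_sim_words\<close>) the distortion is then a sum over cylinders, in which only
  the number of copies of each kind matters. For \<open>beta_set\<close> this needs \<open>r\<close> to be at
  most \<open>(5 - sqrt 17) / 2\<close>.

  Let \<open>V\<close> be the variance of the measure. The two-point and four-point sets have distortions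
  \<open>r\<^sup>2 V\<close> and \<open>r\<^sup>4 V\<close>. A pair of sibling cylinders in which
  \<open>beta_set\<close> splits exactly one contributes the mean \<open>W\<close> of these. The three-point set
  has, as long as each of its points serves exactly the cylinders of which it is the conditional mean, that is
  up to \<open>r_plus\<close> in the range considered, a distortion \<open>D\<close> with \<open>W - D\<close> a
  positive multiple of the polynomial whose root is \<open>r_zero\<close>
  (\<open>distortion_gamma_three\<close>). The distortions of the two families differ by a positive multiple of
  \<open>W - D\<close>, unless \<open>n\<close> is a power of two (\<open>distortion_difference\<close>). The
  sign of the polynomial finishes the proof: it vanishes at \<open>r_zero\<close> and is positive between
  \<open>r_zero\<close> and \<open>1/2\<close>.
\<close>

section \<open>Similitudes and words\<close>

lemma sim_measurable [measurable]: "sim r i \<in> borel_measurable borel"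
  unfolding sim_def[abs_def] by (cases "i = 1") simp_all

lemma sim_word_eq: "sim_word r w x = r ^ length w * x + sim_word r w 0"
  by (induction w) (auto simp: sim_def algebra_simps)

lemma sim_word_measurable [measurable]: "sim_word r w \<in> borel_measurable borel"
  by (subst sim_word_eq[abs_def]) measurable

lemma sim_word_append: "sim_word r (v @ w) x = sim_word r v (sim_word r w x)"
  by (induction v) auto

lemma words_0 [simp]: "words 0 = {[]}"
  by (auto simp: words_def)

lemma words_Suc: "words (Suc k) = (#) 1 ` words k \<union> (#) 2 ` words k"
  unfolding words_def by (auto simp: length_Suc_conv image_iff)

lemma finite_words [simp]: "finite (words k)"
  by (induction k) (auto simp: words_Suc)

lemma sum_words_Suc:
  "(\<Sum>w\<in>words (Suc k). g w) = (\<Sum>w\<in>words k. g (1 # w)) + (\<Sum>w\<in>words k. g (2 # w))"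
  unfolding words_Suc
  by (subst sum.union_disjoint) (auto simp: sum.reindex)

lemma card_words [simp]: "card (words k) = 2 ^ k"
proof (induction k)
  case (Suc k)
  then show ?case using sum_words_Suc[of "\<lambda>_. 1::nat" k] by simp
qed simp

lemma ell_bounds:
  assumes "1 \<le> n"
  shows "2 ^ ell n \<le> n" "n < 2 ^ (ell n + 1)"
proof -
  obtain l :: nat where l: "2 ^ l \<le> n" "n < 2 ^ (l + 1)"
    using ex_power_ivl1[of 2 n] assms by auto
  have uniq: "k = l" if k: "2 ^ k \<le> n \<and> n < 2 ^ (k + 1)" for k
  proof -
    have "(2::nat) ^ k < 2 ^ (l + 1)" "(2::nat) ^ l < 2 ^ (k + 1)" using k l by linarith+
    then have "k < l + 1" "l < k + 1" using power_less_imp_less_exp[of "2::nat" k "l + 1"]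
        power_less_imp_less_exp[of "2::nat" l "k + 1"] by linarith+
    then show ?thesis by simp
  qed
  have "ell n = l" unfolding ell_def by (rule the_equality) (fact conjI[OF l], fact uniq)
  then show "2 ^ ell n \<le> n" "n < 2 ^ (ell n + 1)" using l by simp_all
qed

lemma sum_two_valued_words:
  fixes x y :: real
  assumes "I \<subseteq> words k"
  shows "(\<Sum>w\<in>words k. if w \<in> I then x else y) = real (card I) * x + (2 ^ k - real (card I)) * y"
proof -
  have fin: "finite I" using assms finite_words finite_subset by blast
  have "card I \<le> 2 ^ k" using card_mono[OF finite_words assms] by simp
  then have "real (card (words k - I)) = 2 ^ k - real (card I)"
    using fin assms by (simp add: card_Diff_subset of_nat_diff)
  moreover have "words k \<inter> I = I" "words k \<inter> - I = words k - I" using assms by auto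
  ultimately show ?thesis by (simp add: sum.If_cases)
qed

section \<open>The self-similar measure\<close>

locale cantor = prob_space P for P :: "real measure" +
  fixes r :: real
  assumes ratio: "0 < r" "r < 1/2"
    and cantor_distribution: "cantor_distribution r P"
begin

lemma sets_eq_borel [measurable_cong, simp]: "sets P = sets borel"
  using cantor_distribution unfolding cantor_distribution_def by simp

lemma space_eq_UNIV [simp]: "space P = UNIV"
  using sets_eq_imp_space_eq[OF sets_eq_borel] by simp

lemma prob_UNIV [simp]: "prob UNIV = 1"
  using prob_space by simp

lemma measurable_eq_borel [simp]: "measurable P = measurable borel"
  by (intro ext measurable_cong_sets) auto

lemma prob_self_similar:
  assumes "A \<in> sets borel"
  shows "prob A = 1/2 * prob (sim r 1 -` A) + 1/2 * prob (sim r 2 -` A)"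
  using cantor_distribution assms unfolding cantor_distribution_def
  by (simp add: measure_distr)

lemma sim_unit:
  assumes x: "x \<in> {0..1}"
  shows "sim r i x \<in> {0..1}"
proof -
  have "r * x \<le> r" "0 \<le> r * x" using x ratio by (auto intro: mult_left_le)
  moreover from this have "0 \<le> r * x + 1 - r" "r * x + 1 - r \<le> 1" "r * x \<le> 1"
    using ratio by linarith+
  ultimately show ?thesis
    unfolding sim_def atLeastAtMost_iff by (cases "i = 1") (simp_all only: if_True if_False simp_thms)
qed

lemma sim_word_unit: "x \<in> {0..1} \<Longrightarrow> sim_word r w x \<in> {0..1}"
proof (induction w)
  case (Cons i w)
  then show ?case using sim_unit[of "sim_word r w x" i] by simp
qed simp

text \<open>
  Both similitudes shrink the distance to the unit interval by the factor \<open>r\<close>, so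
  self-similarity bounds the mass at distance more than \<open>t\<close> by the mass at distance more than
  \<open>t / r\<close>, hence by the mass at distance more than \<open>t / r ^ k\<close> for every \<open>k\<close>. The latter tends to
  \<open>0\<close>, because the measure is finite.
\<close>

lemma AE_unit: "AE x in P. x \<in> {0..1}"
proof -
  \<comment> \<open>The points at distance more than \<open>t\<close> from the unit interval.\<close>
  define A where "A t = {..<- t} \<union> {1 + t<..}" for t :: real
  have A_borel [measurable]: "A t \<in> sets borel" for t unfolding A_def by measurable
  have step: "prob (A t) \<le> prob (A (t / r))" if "t > 0" for t
  proof -
    have "sim r i -` A t \<subseteq> A (t / r)" for i
    proof
      fix x assume x: "x \<in> sim r i -` A t"
      have *: "x < - (t / r) \<longleftrightarrow> r * x < - t" "1 + t / r < x \<longleftrightarrow> r + t < r * x"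
        using ratio by (auto simp: field_simps)
      show "x \<in> A (t / r)" using x ratio unfolding A_def * Un_iff lessThan_iff greaterThan_iff
        by (auto simp: sim_def * split: if_splits)
    qed
    then have "prob (sim r i -` A t) \<le> prob (A (t / r))" for i
      by (intro finite_measure_mono) auto
    from this[of 1] this[of 2] show ?thesis using prob_self_similar[of "A t"] by simp
  qed
  have zero: "prob (A t) = 0" if t: "t > 0" for t
  proof -
    have le: "prob (A t) \<le> prob (A (t / r ^ k))" for k
    proof (induction k)
      case (Suc k)
      have "prob (A (t / r ^ k)) \<le> prob (A (t / r ^ k / r))" using ratio t by (intro step) auto
      then show ?case using Suc by (simp add: mult.commute)
    qed simp
    have lim: "(\<lambda>k. prob (A (real k))) \<longlonglongrightarrow> prob (\<Inter>k. A (real k))"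
    proof (rule finite_Lim_measure_decseq)
      show "decseq (\<lambda>k. A (real k))" unfolding decseq_def A_def by auto
    qed auto
    have "x \<notin> (\<Inter>k. A (real k))" for x
    proof -
      obtain k where "real k > \<bar>x\<bar>" using reals_Archimedean2 by blast
      then have "x \<notin> A (real k)" unfolding A_def by auto
      then show ?thesis by blast
    qed
    then have "(\<Inter>k. A (real k)) = {}" by blast
    then have lim0: "(\<lambda>k. prob (A (real k))) \<longlonglongrightarrow> 0" using lim by simp
    have "prob (A t) \<le> prob (A (real n))" for n
    proof -
      obtain k where k: "(1 / r) ^ k > real n / t"
        using real_arch_pow[of "1 / r"] ratio by auto
      then have "real n \<le> t / r ^ k" using t ratio by (auto simp: field_simps power_divide)
      then have "A (t / r ^ k) \<subseteq> A (real n)" unfolding A_def by auto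
      then have "prob (A (t / r ^ k)) \<le> prob (A (real n))" by (intro finite_measure_mono) auto
      then show ?thesis using le[of k] by linarith
    qed
    then have "prob (A t) \<le> 0" using LIMSEQ_le_const[OF lim0] by blast
    then show ?thesis using measure_nonneg[of P "A t"] by linarith
  qed
  have "AE x in P. \<forall>n. x \<notin> A (1 / Suc n)"
    unfolding AE_all_countable
  proof
    fix n
    have "emeasure P (A (1 / Suc n)) = 0" using zero[of "1 / Suc n"] by (simp add: emeasure_eq_measure)
    then show "AE x in P. x \<notin> A (1 / Suc n)"
      by (intro AE_I[of _ _ "A (1 / Suc n)"]) auto
  qed
  then show ?thesis
  proof eventually_elim
    case (elim x)
    have *: "- x \<le> 1 / Suc n" "x - 1 \<le> 1 / Suc n" for n
      using elim[rule_format, of n] unfolding A_def by auto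
    have l: "(\<lambda>n. 1 / real (Suc n)) \<longlonglongrightarrow> 0" using LIMSEQ_inverse_real_of_nat
      by (simp add: inverse_eq_divide)
    have "- x \<le> 0" "x - 1 \<le> 0" using * LIMSEQ_le_const[OF l] by blast+
    then show ?case by simp
  qed
qed

lemma nn_integral_self_similar:
  fixes f :: "real \<Rightarrow> ennreal"
  assumes "f \<in> borel_measurable borel"
  shows "(\<integral>\<^sup>+x. f x \<partial>P) = ennreal (1/2) * (\<integral>\<^sup>+x. f (sim r 1 x) \<partial>P) + ennreal (1/2) * (\<integral>\<^sup>+x. f (sim r 2 x) \<partial>P)"
  using assms
proof (induction f rule: borel_measurable_induct)
  case (cong f g)
  then have "f = g" by auto
  with cong show ?case by simp
next
  case (set A)
  have *: "(\<integral>\<^sup>+x. indicator A (sim r i x) \<partial>P) = ennreal (prob (sim r i -` A))" for i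
  proof -
    have "sim r i -` A \<in> sets borel" using measurable_sets[OF sim_measurable[of r i] set] by simp
    moreover have "(\<lambda>x. indicator A (sim r i x) :: ennreal) = indicator (sim r i -` A)"
      by (auto simp: indicator_def)
    ultimately show ?thesis by (simp add: emeasure_eq_measure)
  qed
  have "(\<integral>\<^sup>+x. indicator A x \<partial>P) = ennreal (prob A)"
    using set by (simp add: emeasure_eq_measure)
  also have "\<dots> = ennreal (1/2) * ennreal (prob (sim r 1 -` A)) + ennreal (1/2) * ennreal (prob (sim r 2 -` A))"
    by (subst prob_self_similar[OF set]) (simp only: ennreal_mult[symmetric] ennreal_plus[symmetric] measure_nonneg
        mult_nonneg_nonneg zero_le_divide_1_iff zero_le_numeral)
  finally show ?case unfolding * .
next
  case (mult u c)
  note [measurable] = mult(2)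
  show ?case
    by (simp add: nn_integral_cmult mult distrib_left mult_ac)
next
  case (add u v)
  note [measurable] = \<open>u \<in> borel_measurable borel\<close> \<open>v \<in> borel_measurable borel\<close>
  show ?case
    by (simp add: nn_integral_add add distrib_left add_ac)
next
  case (seq U)
  note [measurable] = seq(1)
  have *: "(\<integral>\<^sup>+x. (SUP i. U i) (h x) \<partial>P) = (SUP i. \<integral>\<^sup>+x. U i (h x) \<partial>P)"
    if [measurable]: "h \<in> borel_measurable borel" for h
    using \<open>incseq U\<close> by (subst nn_integral_monotone_convergence_SUP[symmetric])
      (auto simp: incseq_def le_fun_def image_comp)
  have inc: "incseq (\<lambda>i. ennreal (1/2) * (\<integral>\<^sup>+x. U i (sim r j x) \<partial>P))" for j
    using \<open>incseq U\<close> unfolding incseq_def le_fun_def by (auto intro!: mult_left_mono nn_integral_mono)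
  have "(\<integral>\<^sup>+x. (SUP i. U i) x \<partial>P) = (SUP i. \<integral>\<^sup>+x. U i x \<partial>P)" using *[of "\<lambda>x. x"] by simp
  also have "\<dots> = (SUP i. ennreal (1/2) * (\<integral>\<^sup>+x. U i (sim r 1 x) \<partial>P) + ennreal (1/2) * (\<integral>\<^sup>+x. U i (sim r 2 x) \<partial>P))"
    by (simp only: seq.IH)
  also have "\<dots> = (SUP i. ennreal (1/2) * (\<integral>\<^sup>+x. U i (sim r 1 x) \<partial>P)) + (SUP i. ennreal (1/2) * (\<integral>\<^sup>+x. U i (sim r 2 x) \<partial>P))"
    by (rule ennreal_SUP_add[OF inc inc])
  also have "\<dots> = ennreal (1/2) * (SUP i. \<integral>\<^sup>+x. U i (sim r 1 x) \<partial>P) + ennreal (1/2) * (SUP i. \<integral>\<^sup>+x. U i (sim r 2 x) \<partial>P)"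
    by (simp add: SUP_mult_left_ennreal)
  finally show ?case by (simp only: *[OF sim_measurable])
qed

text \<open>
  The class of integrands for which the self-similarity equation is used. Boundedness is only
  required on the unit interval, which carries the measure; the class then contains all continuous
  functions and is closed under composition with the similitudes.
\<close>

definition bounded_measurable :: "(real \<Rightarrow> real) \<Rightarrow> bool" where
  "bounded_measurable f \<longleftrightarrow> f \<in> borel_measurable borel \<and> (\<exists>B. \<forall>x\<in>{0..1}. \<bar>f x\<bar> \<le> B)"

lemma bounded_measurable_continuous:
  assumes "continuous_on UNIV f"
  shows "bounded_measurable f"
proof -
  have "compact (f ` {0..1})"
    by (intro compact_continuous_image continuous_on_subset[OF assms]) auto
  then have "bounded (f ` {0..1})" by (rule compact_imp_bounded)
  then show ?thesis using assms unfolding bounded_measurable_def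
    by (auto simp: bounded_iff borel_measurable_continuous_onI)
qed

lemma bounded_measurable_sim:
  assumes "bounded_measurable f"
  shows "bounded_measurable (\<lambda>x. f (sim r i x))"
proof -
  obtain B where f: "f \<in> borel_measurable borel" "\<forall>x\<in>{0..1}. \<bar>f x\<bar> \<le> B"
    using assms unfolding bounded_measurable_def by blast
  have "\<forall>x\<in>{0..1}. \<bar>f (sim r i x)\<bar> \<le> B" using f(2) sim_unit by blast
  then show ?thesis unfolding bounded_measurable_def
    using measurable_compose[OF sim_measurable f(1)] by blast
qed

lemma bounded_measurable_integrable:
  assumes "bounded_measurable f"
  shows "integrable P f"
proof -
  obtain B where f: "f \<in> borel_measurable borel" "\<forall>x\<in>{0..1}. \<bar>f x\<bar> \<le> B"
    using assms unfolding bounded_measurable_def by blast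
  show ?thesis
    using f AE_unit by (intro integrable_const_bound[of _ B]) auto
qed

lemma integral_self_similar:
  assumes "bounded_measurable f"
  shows "(\<integral>x. f x \<partial>P) = 1/2 * (\<integral>x. f (sim r 1 x) \<partial>P) + 1/2 * (\<integral>x. f (sim r 2 x) \<partial>P)"
proof -
  have [measurable]: "f \<in> borel_measurable borel" using assms unfolding bounded_measurable_def by simp
  have int: "integrable P f" "integrable P (\<lambda>x. f (sim r 1 x))" "integrable P (\<lambda>x. f (sim r 2 x))"
    using assms bounded_measurable_sim bounded_measurable_integrable by blast+
  have *: "enn2real (ennreal (1/2) * a + ennreal (1/2) * b) = 1/2 * enn2real a + 1/2 * enn2real b"
    if ab: "a \<noteq> \<top>" "b \<noteq> \<top>" for a b
  proof -
    obtain p where "a = ennreal p" "0 \<le> p" using ab(1) by (cases a) auto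
    moreover obtain q where "b = ennreal q" "0 \<le> q" using ab(2) by (cases b) auto
    ultimately show ?thesis
      by (simp only: ennreal_mult[symmetric] ennreal_plus[symmetric] enn2real_ennreal
        mult_nonneg_nonneg add_nonneg_nonneg zero_le_divide_1_iff zero_le_numeral)
  qed
  show ?thesis
    unfolding real_lebesgue_integral_def[OF int(1)] real_lebesgue_integral_def[OF int(2)]
      real_lebesgue_integral_def[OF int(3)]
    using int
    by (subst (1 2) nn_integral_self_similar)
       (auto simp: * real_integrable_def algebra_simps diff_divide_distrib simp del: ennreal_half)
qed

text \<open>
  Iterating the self-similarity \<open>k\<close> times expresses an integral through the \<open>2 ^ k\<close> cylinders of
  level \<open>k\<close>, each of which carries a scaled copy of the measure of mass \<open>2\<close> to the power \<open>- k\<close>.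
\<close>

lemma integral_sim_words:
  assumes "bounded_measurable f"
  shows "(\<integral>x. f x \<partial>P) = (\<Sum>w\<in>words k. (1/2) ^ k * (\<integral>x. f (sim_word r w x) \<partial>P))"
  using assms
proof (induction k arbitrary: f)
  case (Suc k)
  have "(\<integral>x. f x \<partial>P) = 1/2 * (\<integral>x. f (sim r 1 x) \<partial>P) + 1/2 * (\<integral>x. f (sim r 2 x) \<partial>P)"
    by (rule integral_self_similar[OF Suc.prems])
  also have "(\<integral>x. f (sim r 1 x) \<partial>P) = (\<Sum>w\<in>words k. (1/2) ^ k * (\<integral>x. f (sim_word r (1 # w) x) \<partial>P))"
    by (subst Suc.IH[OF bounded_measurable_sim[OF Suc.prems]]) simp
  also have "(\<integral>x. f (sim r 2 x) \<partial>P) = (\<Sum>w\<in>words k. (1/2) ^ k * (\<integral>x. f (sim_word r (2 # w) x) \<partial>P))"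
    by (subst Suc.IH[OF bounded_measurable_sim[OF Suc.prems]]) simp
  finally show ?case
    by (simp only: sum_words_Suc sum_distrib_left) (simp add: mult.assoc)
qed simp

section \<open>Separation of cylinders and distortion of a tiling\<close>

lemma sim_word_diff: "sim_word r w x - sim_word r w y = r ^ length w * (x - y)"
  using sim_word_eq[of r w x] sim_word_eq[of r w y] by (simp add: algebra_simps)

text \<open>
  Right of the first cylinder of level one there is a hole of length \<open>1 - 2 * r\<close>. To it one adds
  the distance from \<open>x\<close> to the right end of its cylinder of level \<open>Suc k\<close>, and that from \<open>y\<close> to the
  left end of its own. The estimate keeps only the \<open>r ^ k\<close>-fold of the hole, which is what is left
  of it when the words first differ at the last letter.
\<close>

lemma gap_distinct_first_letters:
  assumes "length w = k" "length v = k" "x \<in> {0..1}" "y \<in> {0..1}"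
  shows "r ^ Suc k * (1 - 2 * r + r * (1 - x + y)) \<le> r * (sim_word r (2 # v) y - sim_word r (1 # w) x)"
proof -
  have "r ^ k * y \<le> sim_word r v y"
    using sim_word_diff[of v y 0] sim_word_unit[of 0 v] assms by auto
  then have v: "r * (r ^ k * y) \<le> r * sim_word r v y" using ratio by simp
  have "sim_word r w x \<le> 1 - r ^ k * (1 - x)"
    using sim_word_diff[of w 1 x] sim_word_unit[of 1 w] assms by auto
  then have w: "r * sim_word r w x \<le> r * (1 - r ^ k * (1 - x))" using ratio by simp
  have "r ^ k \<le> 1" using ratio by (intro power_le_one) auto
  then have "r ^ k * (1 - 2 * r) \<le> 1 * (1 - 2 * r)" using ratio by (intro mult_right_mono) auto
  then have "r ^ k * (1 - 2 * r + r * (1 - x + y)) \<le> sim_word r (2 # v) y - sim_word r (1 # w) x"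
    using v w by (simp add: sim_def algebra_simps)
  then have "r * (r ^ k * (1 - 2 * r + r * (1 - x + y))) \<le> r * (sim_word r (2 # v) y - sim_word r (1 # w) x)"
    using ratio by (intro mult_left_mono) auto
  then show ?thesis by (simp only: power_Suc mult.assoc)
qed

text \<open>
  A common first letter only scales the configuration by \<open>r\<close>, which reduces the claim to words
  that differ in their first letters. The disjunction records which of the two cylinders lies to
  the left. Everything is multiplied by \<open>r\<close> because the hole between siblings of level \<open>k\<close> has
  length \<open>r ^ (k - 1) * (1 - 2 * r)\<close>.
\<close>

lemma gap:
  assumes "w \<in> words k" "v \<in> words k" "w \<noteq> v" "x \<in> {0..1}" "y \<in> {0..1}"
  shows "r ^ k * (1 - 2 * r + r * (1 - x + y)) \<le> r * (sim_word r v y - sim_word r w x)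
       \<or> r ^ k * (1 - 2 * r + r * (1 - y + x)) \<le> r * (sim_word r w x - sim_word r v y)"
  using assms
proof (induction k arbitrary: w v)
  case (Suc k)
  then obtain i j w' v' where wv: "w = i # w'" "v = j # v'" "w' \<in> words k" "v' \<in> words k"
    "i \<in> {1, 2}" "j \<in> {1, 2}"
    unfolding words_Suc by auto
  have len: "length w' = k" "length v' = k" using wv by (auto simp: words_def)
  consider "i = j" | "i = 1" "j = 2" | "i = 2" "j = 1" using wv by auto
  then show ?case
  proof cases
    case 1
    have scale: "r ^ Suc k * c \<le> r * (sim r i p - sim r i q)" if "r ^ k * c \<le> r * (p - q)" for c p q
    proof -
      have "r * (r ^ k * c) \<le> r * (r * (p - q))" using that ratio by (intro mult_left_mono) auto
      then show ?thesis by (simp add: sim_def algebra_simps)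
    qed
    have "w' \<noteq> v'" using 1 wv Suc.prems by auto
    from Suc.IH[OF wv(3,4) this Suc.prems(4,5)] show ?thesis
      using scale unfolding wv 1[symmetric] sim_word.simps by blast
  next
    case 2
    then show ?thesis using gap_distinct_first_letters[OF len Suc.prems(4,5)] wv by simp
  next
    case 3
    then show ?thesis
      using gap_distinct_first_letters[OF len(2,1) Suc.prems(5,4)] wv by simp
  qed
qed simp

lemma bounded_measurable_square_distance:
  assumes "finite \<alpha>" "\<alpha> \<noteq> {}"
  shows "bounded_measurable (\<lambda>x. MIN a\<in>\<alpha>. (x - a)\<^sup>2)"
proof -
  have "continuous_on UNIV (\<lambda>x::real. MIN a\<in>\<alpha>. (x - a)\<^sup>2)"
    using assms
  proof (induction \<alpha> rule: finite_ne_induct)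
    case (insert a \<alpha>)
    then have "(\<lambda>x. MIN b\<in>insert a \<alpha>. (x - b)\<^sup>2) = (\<lambda>x. min ((x - a)\<^sup>2) (MIN b\<in>\<alpha>. (x - b)\<^sup>2))"
      by auto
    then show ?case using insert by (auto intro!: continuous_intros)
  qed (auto intro!: continuous_intros)
  then show ?thesis by (rule bounded_measurable_continuous)
qed

text \<open>
  Point sets that may be copied into the cylinders of a level independently of one another: if all
  of them are tiles with the same \<open>m\<close>, then a point of a cylinder is never closer to the copy in
  another cylinder than to the copy in its own. The number \<open>m\<close> is the margin which all copies keep
  from the ends of their cylinders. The two symmetric points \<open>a\<close> and \<open>1 - a\<close> ensure that points
  near an end have a close enough neighbour; the last inequality compares, at the very end of a
  cylinder and after multiplication by \<open>r\<close>, the distance \<open>a\<close> with hole plus margin.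
\<close>

definition tile :: "real \<Rightarrow> real set \<Rightarrow> bool" where
  "tile m A \<longleftrightarrow> finite A \<and> A \<subseteq> {m..1 - m} \<and>
     (\<exists>a. a \<in> A \<and> 1 - a \<in> A \<and> 0 \<le> a \<and> a \<le> 1/2 \<and> r * a \<le> 1 - 2 * r + r * m)"

text \<open>
  By the defining property of tiles, the minimum over the union may be replaced on each cylinder by
  the minimum over the copy in that cylinder. There the scaling contributes \<open>r ^ (2 * k)\<close>, and the
  mass of the cylinder the factor \<open>(1/2) ^ k\<close>.
\<close>

lemma distortion_tiling:
  assumes tile: "\<And>w. w \<in> words k \<Longrightarrow> tile m (A w)" and m: "0 \<le> m"
  shows "distortion P (\<Union>w\<in>words k. sim_word r w ` A w)
       = (\<Sum>w\<in>words k. (1/2) ^ k * (r ^ (2 * k) * distortion P (A w)))"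
proof -
  have A: "finite (A w)" "A w \<subseteq> {m..1 - m}" if "w \<in> words k" for w
    using tile[OF that] unfolding tile_def by auto
  have "\<forall>w\<in>words k. \<exists>a. a \<in> A w \<and> 1 - a \<in> A w \<and> 0 \<le> a \<and> a \<le> 1/2 \<and> r * a \<le> 1 - 2 * r + r * m"
    using tile unfolding tile_def by blast
  then obtain a where "\<forall>w\<in>words k. a w \<in> A w \<and> 1 - a w \<in> A w \<and> 0 \<le> a w \<and> a w \<le> 1/2
      \<and> r * a w \<le> 1 - 2 * r + r * m"
    by (auto dest: bchoice)
  then have a: "a w \<in> A w" "1 - a w \<in> A w" "0 \<le> a w" "a w \<le> 1/2"
      "r * a w \<le> 1 - 2 * r + r * m" if "w \<in> words k" for w
    using that by auto
  define \<alpha> where "\<alpha> = (\<Union>w\<in>words k. sim_word r w ` A w)"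
  have fin: "finite \<alpha>" unfolding \<alpha>_def using A by auto
  have "words k \<noteq> {}" using card_words[of k] by force
  then have ne: "\<alpha> \<noteq> {}" unfolding \<alpha>_def using a(1) by blast
  have local_min: "(MIN b\<in>\<alpha>. (sim_word r w x - b)\<^sup>2) = r ^ (2 * k) * (MIN a\<in>A w. (x - a)\<^sup>2)"
    if w: "w \<in> words k" and x: "x \<in> {0..1}" for w x
  proof -
    have len: "length w = k" using w by (simp add: words_def)
    have own: "(sim_word r w x - sim_word r w b)\<^sup>2 = r ^ (2 * k) * (x - b)\<^sup>2" for b
      unfolding sim_word_diff len by (simp add: power_mult_distrib power_mult[symmetric] mult.commute)
    have "Min ((\<lambda>a. (x - a)\<^sup>2) ` A w) \<in> (\<lambda>a. (x - a)\<^sup>2) ` A w"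
      using A(1)[OF w] a(1)[OF w] by (intro Min_in) auto
    then obtain c where c: "c \<in> A w" "(MIN a\<in>A w. (x - a)\<^sup>2) = (x - c)\<^sup>2" by auto
    have least: "(x - c)\<^sup>2 \<le> (x - d)\<^sup>2" if "d \<in> A w" for d
      unfolding c(2)[symmetric] using A(1)[OF w] that by (intro Min_le) auto
    have "(MIN b\<in>\<alpha>. (sim_word r w x - b)\<^sup>2) = r ^ (2 * k) * (x - c)\<^sup>2"
    proof (rule Min_eqI)
      show "finite ((\<lambda>b. (sim_word r w x - b)\<^sup>2) ` \<alpha>)" using fin by simp
      show "r ^ (2 * k) * (x - c)\<^sup>2 \<in> (\<lambda>b. (sim_word r w x - b)\<^sup>2) ` \<alpha>"
        unfolding own[symmetric] \<alpha>_def using w c by blast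
      fix z assume "z \<in> (\<lambda>b. (sim_word r w x - b)\<^sup>2) ` \<alpha>"
      then obtain v b where v: "v \<in> words k" "b \<in> A v" "z = (sim_word r w x - sim_word r v b)\<^sup>2"
        unfolding \<alpha>_def by auto
      show "r ^ (2 * k) * (x - c)\<^sup>2 \<le> z"
      proof (cases "v = w")
        case True
        then show ?thesis using v least[of b] ratio by (simp add: own mult_left_mono)
      next
        case False
        have b: "m \<le> b" "b \<le> 1 - m" using A(2)[OF v(1)] v(2) by auto
        have b01: "b \<in> {0..1}" using b m by auto
        \<comment> \<open>The one of the two symmetric points that lies in the same half as \<open>x\<close>: it
            is within \<open>1/2\<close> of \<open>x\<close>, which suffices if the competitor is beyond the far
            end; at the near end the margin is used.\<close>
        define d where "d = (if x \<le> 1/2 then a w else 1 - a w)"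
        have d: "d \<in> A w" unfolding d_def using a(1,2)[OF w] by simp
        note aw = a(3-5)[OF w]
        have "r * \<bar>x - d\<bar> \<le> 1 - 2 * r + r * t" if t: "\<bar>x - d\<bar> \<le> t \<or> \<bar>x - d\<bar> \<le> a w + (t - m)" for t
        proof -
          have "r * \<bar>x - d\<bar> \<le> r * t \<or> r * \<bar>x - d\<bar> \<le> r * (a w + (t - m))"
            using t ratio by (auto intro: mult_left_mono)
          then show ?thesis using aw(3) ratio unfolding distrib_left right_diff_distrib
            by (elim disjE) linarith+
        qed
        moreover have "\<bar>x - d\<bar> \<le> 1 - x + b \<or> \<bar>x - d\<bar> \<le> a w + (1 - x + b - m)"
          "\<bar>x - d\<bar> \<le> 1 - b + x \<or> \<bar>x - d\<bar> \<le> a w + (1 - b + x - m)"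
          using aw b x m unfolding d_def by (auto simp: abs_le_iff)
        ultimately have bound: "r * \<bar>x - d\<bar> \<le> 1 - 2 * r + r * (1 - x + b)"
          "r * \<bar>x - d\<bar> \<le> 1 - 2 * r + r * (1 - b + x)"
          by blast+
        have "r ^ k * (r * \<bar>x - d\<bar>) \<le> r * \<bar>sim_word r w x - sim_word r v b\<bar>"
          using gap[OF w v(1) False[symmetric] x b01]
        proof (elim disjE)
          assume h: "r ^ k * (1 - 2 * r + r * (1 - x + b)) \<le> r * (sim_word r v b - sim_word r w x)"
          have "r ^ k * (r * \<bar>x - d\<bar>) \<le> r ^ k * (1 - 2 * r + r * (1 - x + b))"
            using bound(1) ratio by (intro mult_left_mono) auto
          also note h
          also have "r * (sim_word r v b - sim_word r w x) \<le> r * \<bar>sim_word r w x - sim_word r v b\<bar>"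
            using ratio by (intro mult_left_mono) auto
          finally show ?thesis .
        next
          assume h: "r ^ k * (1 - 2 * r + r * (1 - b + x)) \<le> r * (sim_word r w x - sim_word r v b)"
          have "r ^ k * (r * \<bar>x - d\<bar>) \<le> r ^ k * (1 - 2 * r + r * (1 - b + x))"
            using bound(2) ratio by (intro mult_left_mono) auto
          also note h
          also have "r * (sim_word r w x - sim_word r v b) \<le> r * \<bar>sim_word r w x - sim_word r v b\<bar>"
            using ratio by (intro mult_left_mono) auto
          finally show ?thesis .
        qed
        then have "r * \<bar>r ^ k * (x - d)\<bar> \<le> r * \<bar>sim_word r w x - sim_word r v b\<bar>"
          using ratio by (simp add: abs_mult mult_ac)
        then have "\<bar>r ^ k * (x - d)\<bar> \<le> \<bar>sim_word r w x - sim_word r v b\<bar>"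
          using ratio by simp
        then have "(r ^ k * (x - d))\<^sup>2 \<le> z" unfolding v(3) by (rule abs_le_square_iff[THEN iffD1])
        moreover have "r ^ (2 * k) * (x - c)\<^sup>2 \<le> r ^ (2 * k) * (x - d)\<^sup>2"
          using least[OF d] ratio by (intro mult_left_mono) auto
        ultimately show ?thesis by (simp add: power_mult_distrib power_mult[symmetric] mult.commute)
      qed
    qed
    then show ?thesis using c(2) by simp
  qed
  have "distortion P \<alpha> = (\<Sum>w\<in>words k. (1/2) ^ k * (\<integral>x. (MIN b\<in>\<alpha>. (sim_word r w x - b)\<^sup>2) \<partial>P))"
    unfolding distortion_def
    by (rule integral_sim_words[OF bounded_measurable_square_distance[OF fin ne]])
  also have "\<dots> = (\<Sum>w\<in>words k. (1/2) ^ k * (r ^ (2 * k) * distortion P (A w)))"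
  proof (rule sum.cong[OF refl])
    fix w assume w: "w \<in> words k"
    have "A w \<noteq> {}" using a(1)[OF w] by blast
    then have 1: "bounded_measurable (\<lambda>x. MIN b\<in>A w. (x - b)\<^sup>2)"
      using A(1)[OF w] bounded_measurable_square_distance by blast
    have 2: "(\<lambda>x. MIN b\<in>\<alpha>. (x - b)\<^sup>2) \<in> borel_measurable borel"
      using bounded_measurable_square_distance[OF fin ne] unfolding bounded_measurable_def by blast
    have "(\<integral>x. (MIN b\<in>\<alpha>. (sim_word r w x - b)\<^sup>2) \<partial>P) = (\<integral>x. r ^ (2 * k) * (MIN b\<in>A w. (x - b)\<^sup>2) \<partial>P)"
    proof (rule integral_cong_AE)
      show "AE x in P. (MIN b\<in>\<alpha>. (sim_word r w x - b)\<^sup>2) = r ^ (2 * k) * (MIN b\<in>A w. (x - b)\<^sup>2)"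
        using AE_unit by eventually_elim (rule local_min[OF w])
      show "(\<lambda>x. MIN b\<in>\<alpha>. (sim_word r w x - b)\<^sup>2) \<in> borel_measurable P"
        using measurable_compose[OF sim_word_measurable 2] by simp
      show "(\<lambda>x. r ^ (2 * k) * (MIN b\<in>A w. (x - b)\<^sup>2)) \<in> borel_measurable P"
        using 1 unfolding bounded_measurable_def by (auto intro: borel_measurable_times)
    qed
    then show "(1/2) ^ k * (\<integral>x. (MIN b\<in>\<alpha>. (sim_word r w x - b)\<^sup>2) \<partial>P)
        = (1/2) ^ k * (r ^ (2 * k) * distortion P (A w))"
      unfolding distortion_def by simp
  qed
  finally show ?thesis unfolding \<alpha>_def .
qed

section \<open>Moments and conditional means\<close>

text \<open>
  Mean and second moment are the solutions of the linear equations that self-similarity imposes on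
  them.
\<close>

lemma expectation_id: "(\<integral>x. x \<partial>P) = 1/2"
proof -
  have int: "integrable P (\<lambda>x. x)"
    by (intro bounded_measurable_integrable bounded_measurable_continuous continuous_intros)
  have "(\<integral>x. x \<partial>P) = 1/2 * (\<integral>x. r * x \<partial>P) + 1/2 * (\<integral>x. r * x + (1 - r) \<partial>P)"
    using integral_self_similar[OF bounded_measurable_continuous[of "\<lambda>x. x"]]
    by (simp add: sim_def add_diff_eq)
  also have "\<dots> = 1/2 * (r * (\<integral>x. x \<partial>P)) + 1/2 * (r * (\<integral>x. x \<partial>P) + (1 - r))"
    using int by simp
  finally have "(1 - r) * ((\<integral>x. x \<partial>P) - 1/2) = 0" by (simp add: field_simps)
  then show ?thesis using ratio by simp
qed

definition variance_cantor :: real where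
  "variance_cantor = (1 - r) / (4 * (1 + r))"

lemma expectation_square: "(\<integral>x. x\<^sup>2 \<partial>P) = variance_cantor + 1/4"
proof -
  let ?E = "\<integral>x. x\<^sup>2 \<partial>P"
  have int: "integrable P (\<lambda>x. x)" "integrable P (\<lambda>x. x\<^sup>2)"
    by (intro bounded_measurable_integrable bounded_measurable_continuous continuous_intros)+
  have "?E = 1/2 * (\<integral>x. (r * x)\<^sup>2 \<partial>P) + 1/2 * (\<integral>x. (r * x + 1 - r)\<^sup>2 \<partial>P)"
    using integral_self_similar[OF bounded_measurable_continuous[of "\<lambda>x. x\<^sup>2"]]
    by (simp add: sim_def continuous_intros)
  also have "(\<lambda>x. (r * x)\<^sup>2) = (\<lambda>x. r\<^sup>2 * x\<^sup>2)" by (simp add: power_mult_distrib)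
  also have "(\<lambda>x. (r * x + 1 - r)\<^sup>2) = (\<lambda>x. r\<^sup>2 * x\<^sup>2 + (2 * r * (1 - r) * x + (1 - r)\<^sup>2))"
    by (auto simp: power2_eq_square algebra_simps)
  also have "(\<integral>x. r\<^sup>2 * x\<^sup>2 + (2 * r * (1 - r) * x + (1 - r)\<^sup>2) \<partial>P)
      = r\<^sup>2 * ?E + (2 * r * (1 - r) * (1/2) + (1 - r)\<^sup>2)"
    using int by (simp add: expectation_id)
  also have "(\<integral>x. r\<^sup>2 * x\<^sup>2 \<partial>P) = r\<^sup>2 * ?E" by simp
  finally have eq: "?E = 1/2 * (r\<^sup>2 * ?E) + 1/2 * (r\<^sup>2 * ?E + (2 * r * (1 - r) * (1/2) + (1 - r)\<^sup>2))" .
  have solve: "e = (1 - r) / (4 * (1 + r)) + 1/4"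
    if "e = 1/2 * (r\<^sup>2 * e) + 1/2 * (r\<^sup>2 * e + (2 * r * (1 - r) * (1/2) + (1 - r)\<^sup>2))" for e
  proof -
    have "(1 - r) * ((1 + r) * e - 1/2)
        = e - (1/2 * (r\<^sup>2 * e) + 1/2 * (r\<^sup>2 * e + (2 * r * (1 - r) * (1/2) + (1 - r)\<^sup>2)))"
      by (simp add: power2_eq_square field_simps)
    also have "\<dots> = 0" using that by linarith
    finally have "(1 + r) * e = 1/2" using ratio by simp
    then show ?thesis using ratio by (simp add: field_simps)
  qed
  show ?thesis unfolding variance_cantor_def by (rule solve[OF eq])
qed

lemma expectation_square_affine:
  "(\<integral>x. (s * x + t)\<^sup>2 \<partial>P) = s\<^sup>2 * variance_cantor + (s / 2 + t)\<^sup>2"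
proof -
  have int: "integrable P (\<lambda>x. x)" "integrable P (\<lambda>x. x\<^sup>2)"
    by (intro bounded_measurable_integrable bounded_measurable_continuous continuous_intros)+
  have "(\<lambda>x. (s * x + t)\<^sup>2) = (\<lambda>x. s\<^sup>2 * x\<^sup>2 + (2 * s * t * x + t\<^sup>2))"
    by (auto simp: power2_eq_square algebra_simps)
  then have "(\<integral>x. (s * x + t)\<^sup>2 \<partial>P) = s\<^sup>2 * (variance_cantor + 1/4) + (2 * s * t * (1/2) + t\<^sup>2)"
    using int by (simp add: expectation_id expectation_square)
  also have "\<dots> = s\<^sup>2 * variance_cantor + (s / 2 + t)\<^sup>2"
    by (simp add: power2_sum power_divide distrib_left)
  finally show ?thesis .
qed

lemma expectation_sim_word: "(\<integral>x. sim_word r w x \<partial>P) = sim_word r w (1/2)"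
proof -
  have "integrable P (\<lambda>x. x)"
    by (intro bounded_measurable_integrable bounded_measurable_continuous continuous_intros)
  then have "(\<integral>x. r ^ length w * x + sim_word r w 0 \<partial>P) = r ^ length w * (1/2) + sim_word r w 0"
    by (simp add: expectation_id)
  then show ?thesis unfolding sim_word_eq[of r w "1/2", symmetric]
    by (subst Bochner_Integration.integral_cong[OF refl sim_word_eq])
qed

lemma J_eq: "J r w = {sim_word r w 0..sim_word r w 1}"
proof -
  have "J r w = (\<lambda>x. r ^ length w * x + sim_word r w 0) ` {0..1}"
    unfolding J_def by (rule image_cong[OF refl sim_word_eq])
  also have "\<dots> = {sim_word r w 0..r ^ length w + sim_word r w 0}"
    using ratio by (subst image_affinity_atLeastAtMost) auto
  finally show ?thesis using sim_word_eq[of r w 1] by simp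
qed

lemma J_borel [measurable]: "J r w \<in> sets borel"
  unfolding J_eq by simp

lemma J_disjoint:
  assumes "w \<in> words k" "v \<in> words k" "w \<noteq> v"
  shows "J r w \<inter> J r v = {}"
proof -
  have False if xy: "x \<in> {0..1}" "y \<in> {0..1}" "sim_word r w x = sim_word r v y" for x y
  proof -
    have "0 < 1 - 2 * r + r * (1 - x + y)" "0 < 1 - 2 * r + r * (1 - y + x)"
      using ratio xy by (auto intro!: add_pos_nonneg)
    then have "0 < r ^ k * (1 - 2 * r + r * (1 - x + y))" "0 < r ^ k * (1 - 2 * r + r * (1 - y + x))"
      using ratio by (auto intro!: mult_pos_pos)
    then show False using gap[OF assms xy(1,2)] xy(3) by (auto simp: not_le[symmetric])
  qed
  then show ?thesis unfolding J_def by fastforce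
qed

lemma set_integral_J:
  assumes w: "w \<in> words k" and g: "bounded_measurable g"
  shows "(LINT x:J r w|P. g x) = (1/2) ^ k * (\<integral>x. g (sim_word r w x) \<partial>P)"
proof -
  let ?f = "\<lambda>x. indicator (J r w) x *\<^sub>R g x"
  obtain B where B: "g \<in> borel_measurable borel" "\<forall>x\<in>{0..1}. \<bar>g x\<bar> \<le> B"
    using g unfolding bounded_measurable_def by blast
  note [measurable] = B(1)
  have "\<forall>x\<in>{0..1}. \<bar>?f x\<bar> \<le> \<bar>B\<bar>" using B(2) by (auto simp: indicator_def intro: order_trans)
  moreover have "?f \<in> borel_measurable borel" by measurable
  ultimately have f: "bounded_measurable ?f" unfolding bounded_measurable_def by blast
  have summand: "(\<integral>x. ?f (sim_word r v x) \<partial>P) = (if v = w then \<integral>x. g (sim_word r w x) \<partial>P else 0)"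
    if v: "v \<in> words k" for v
  proof -
    have "(\<integral>x. ?f (sim_word r v x) \<partial>P) = (\<integral>x. (if v = w then g (sim_word r w x) else 0) \<partial>P)"
    proof (rule integral_cong_AE)
      show "AE x in P. ?f (sim_word r v x) = (if v = w then g (sim_word r w x) else 0)"
        using AE_unit
      proof eventually_elim
        case (elim x)
        then have "sim_word r v x \<in> J r v" unfolding J_def by blast
        then show ?case using J_disjoint[OF w v] by (auto simp: indicator_def)
      qed
    qed auto
    then show ?thesis by simp
  qed
  have "(LINT x:J r w|P. g x) = (\<Sum>v\<in>words k. (1/2) ^ k * (\<integral>x. ?f (sim_word r v x) \<partial>P))"
    unfolding set_lebesgue_integral_def by (rule integral_sim_words[OF f])
  also have "\<dots> = (\<Sum>v\<in>words k. if v = w then (1/2) ^ k * (\<integral>x. g (sim_word r w x) \<partial>P) else 0)"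
    by (intro sum.cong refl, subst summand) auto
  also have "\<dots> = (1/2) ^ k * (\<integral>x. g (sim_word r w x) \<partial>P)" using w by simp
  finally show ?thesis .
qed

lemma prob_J: "w \<in> words k \<Longrightarrow> prob (J r w) = (1/2) ^ k"
  using set_integral_J[of w k "\<lambda>_. 1"]
  by (simp add: bounded_measurable_continuous set_lebesgue_integral_def)

lemma set_integral_J_id: "w \<in> words k \<Longrightarrow> (LINT x:J r w|P. x) = (1/2) ^ k * sim_word r w (1/2)"
  by (simp add: set_integral_J bounded_measurable_continuous continuous_on_id expectation_sim_word)

lemma cmean_single: "w \<in> words k \<Longrightarrow> cmean r P {w} = sim_word r w (1/2)"
  unfolding cmean_def by (simp add: set_integral_J_id prob_J)

text \<open>
  The two words may have different lengths, as in the outer points of the three-point set; disjoint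
  cylinders then enter with different weights.
\<close>

lemma cmean_pair:
  assumes w: "w \<in> words k" and v: "v \<in> words l" and disj: "J r w \<inter> J r v = {}"
  shows "cmean r P {w, v}
    = ((1/2) ^ k * sim_word r w (1/2) + (1/2) ^ l * sim_word r v (1/2)) / ((1/2) ^ k + (1/2) ^ l)"
proof -
  have int: "integrable P (\<lambda>x. x)"
    by (intro bounded_measurable_integrable bounded_measurable_continuous continuous_intros)
  have "set_integrable P (J r u) (\<lambda>x. x)" for u
    unfolding set_integrable_def using int by (intro integrable_mult_indicator) auto
  then have "(LINT x:J r w \<union> J r v|P. x) = (1/2) ^ k * sim_word r w (1/2) + (1/2) ^ l * sim_word r v (1/2)"
    using disj by (simp add: set_integral_Un set_integral_J_id[OF w] set_integral_J_id[OF v])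
  moreover have "prob (J r w \<union> J r v) = (1/2) ^ k + (1/2) ^ l"
    using disj by (simp add: finite_measure_Union prob_J[OF w] prob_J[OF v])
  ultimately show ?thesis unfolding cmean_def by simp
qed

end

section \<open>The two critical parameters\<close>

text \<open>
  This is \<open>-6\<close> times the difference of the two sides of the equation of \<open>r_zero\<close>. It is a positive
  multiple of what the three-point set saves over the mean distortion of the two-point and the
  four-point set, see \<open>distortion_gamma_three\<close>.
\<close>

definition advantage_poly :: "real \<Rightarrow> real" where
  "advantage_poly r = r^7 + r^6 - 2 * r^5 + 4 * r^4 - 8 * r^3 - 2 * r^2 + 9 * r - 3"

lemma r0_equation_iff: "r0_equation r \<longleftrightarrow> advantage_poly r = 0"
proof -
  have "(r - 1) * (r^4 + r^2)
      - 1/6 * (r^7 + r^6 + 4 * r^5 - 2 * r^4 - 2 * r^3 - 8 * r^2 + 9 * r - 3) = - advantage_poly r / 6"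
    unfolding advantage_poly_def by (simp add: algebra_simps eval_nat_numeral)
  then show ?thesis unfolding r0_equation_def by linarith
qed

lemma r_zero_root: "0 < r_zero" "r_zero < 1/2" "advantage_poly r_zero = 0"
  using theI'[OF r_zero_unique, folded r_zero_def] by (auto simp: r0_equation_iff)

text \<open>
  A nonpositive value to the right of \<open>r_zero\<close> would, since the value at \<open>1/2\<close> is positive, force a
  second root in the open interval from \<open>0\<close> to \<open>1/2\<close>.
\<close>

lemma advantage_poly_pos:
  assumes "r_zero < r" "r < 1/2"
  shows "0 < advantage_poly r"
proof (rule ccontr)
  assume neg: "\<not> 0 < advantage_poly r"
  have half: "0 < advantage_poly (1/2)" unfolding advantage_poly_def by (simp add: power_divide)
  have "continuous_on {r..1/2} advantage_poly"
    unfolding advantage_poly_def by (intro continuous_intros)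
  then obtain c where c: "r \<le> c" "c \<le> 1/2" "advantage_poly c = 0"
    using IVT'[of advantage_poly r 0 "1/2"] neg half assms by auto
  moreover have "c \<noteq> 1/2" using c(3) half by (metis order_less_irrefl)
  ultimately have "0 < c \<and> c < 1/2 \<and> r0_equation c"
    unfolding r0_equation_iff using assms r_zero_root by auto
  then have "c = r_zero" using r_zero_unique r_zero_root unfolding r0_equation_iff by blast
  then show False using c assms by simp
qed

text \<open>
  A positive value to the left of \<open>r_plus\<close> would, since the value at \<open>0\<close> is negative, force a
  second root in the open interval from \<open>0\<close> to \<open>1/2\<close>.
\<close>

lemma r_plus_cubic_nonpos:
  assumes "0 < r" "r \<le> r_plus"
  shows "11 * r^3 - 12 * r^2 + 10 * r - 3 \<le> 0"
proof (rule ccontr)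
  let ?f = "\<lambda>r::real. 11 * r^3 - 12 * r^2 + 10 * r - 3"
  assume pos: "\<not> ?f r \<le> 0"
  have root: "0 < r_plus" "r_plus < 1/2" "?f r_plus = 0"
    using theI'[OF r_plus_unique] unfolding r_plus_def[symmetric] by auto
  have "continuous_on {0..r} ?f" by (intro continuous_intros)
  then obtain c where c: "0 \<le> c" "c \<le> r" "?f c = 0"
    using IVT'[of ?f 0 0 r] pos assms by auto
  then have "c \<noteq> 0" "c \<noteq> r" using pos by auto
  then have "0 < c \<and> c < 1/2 \<and> ?f c = 0" using c root assms by auto
  then have "c = r_plus" using r_plus_unique root by blast
  then show False using c \<open>c \<noteq> r\<close> assms by simp
qed

lemma r_plus_less: "r_plus < (5 - sqrt 17) / 2"
proof -
  have "sqrt 17 < 4.1247" by (rule real_less_lsqrt) (simp_all add: power2_eq_square)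
  moreover have "r_plus < 0.43763" using r_plus_approx unfolding abs_less_iff by simp
  ultimately show ?thesis by simp
qed

section \<open>Distortion of the basic tiles\<close>

context cantor
begin

lemma tileI:
  assumes "finite A" "A \<subseteq> {m..1 - m}" "a \<in> A" "1 - a \<in> A" "0 \<le> a" "a \<le> 1/2"
    "r * a \<le> 1 - 2 * r + r * m"
  shows "tile m A"
  using assms unfolding tile_def by blast

text \<open>
  Both families of point sets to be compared put one of two tiles into every cylinder of a level, so
  their distortions depend on the index set only through its cardinality.
\<close>

lemma distortion_mixture:
  assumes "tile m A" "tile m B" "0 \<le> m" "I \<subseteq> words k"
  shows "distortion P ((\<Union>w\<in>I. sim_word r w ` A) \<union> (\<Union>w\<in>words k - I. sim_word r w ` B))
    = (1/2) ^ k * r ^ (2 * k) * (real (card I) * distortion P A + (2 ^ k - real (card I)) * distortion P B)"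
proof -
  let ?A = "\<lambda>w. if w \<in> I then A else B"
  have "(\<Union>w\<in>I. sim_word r w ` A) \<union> (\<Union>w\<in>words k - I. sim_word r w ` B)
      = (\<Union>w\<in>I. sim_word r w ` ?A w) \<union> (\<Union>w\<in>words k - I. sim_word r w ` ?A w)"
    by (intro arg_cong2[of _ _ _ _ "(\<union>)"] SUP_cong) simp_all
  also have "\<dots> = (\<Union>w\<in>words k. sim_word r w ` ?A w)" using assms(4) by blast
  also have "distortion P \<dots> = (\<Sum>w\<in>words k. (1/2) ^ k * (r ^ (2 * k) * distortion P (?A w)))"
    using assms by (intro distortion_tiling[of k m]) auto
  also have "\<dots> = (1/2) ^ k * r ^ (2 * k) * (\<Sum>w\<in>words k. if w \<in> I then distortion P A else distortion P B)"
    by (simp add: sum_distrib_left mult.assoc if_distrib[of "distortion P"])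
  finally show ?thesis unfolding sum_two_valued_words[OF assms(4)] .
qed

lemma distortion_half: "distortion P {1/2} = variance_cantor"
  using expectation_square_affine[of 1 "-1/2"] by (simp add: distortion_def)

lemma distortion_midpoints:
  "distortion P (\<Union>w\<in>words k. sim_word r w ` {1/2}) = r ^ (2 * k) * variance_cantor"
proof -
  have "tile (1/2) {1/2}" by (rule tileI[of _ _ "1/2"]) (use ratio in auto)
  from distortion_mixture[OF this this, of "{}" k] show ?thesis
    by (simp add: distortion_half power_divide)
qed

lemma words_1: "words 1 = {[1], [2]}"
  by (auto simp: words_Suc)

lemma words_2: "words 2 = {[1, 1], [1, 2], [2, 1], [2, 2]}"
  by (auto simp: numeral_2_eq_2 words_Suc)

lemma gamma_two_midpoints: "gamma_two r P = (\<Union>w\<in>words 1. sim_word r w ` {1/2})"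
  unfolding gamma_two_def words_1 by (subst (1 2) cmean_single[of _ 1]) (auto simp: words_def)

lemma gamma_four_midpoints: "gamma_four r P = (\<Union>w\<in>words 2. sim_word r w ` {1/2})"
  unfolding gamma_four_def words_2 by (subst (1 2 3 4) cmean_single[of _ 2]) (auto simp: words_def)

lemma distortion_gamma_two: "distortion P (gamma_two r P) = r^2 * variance_cantor"
  unfolding gamma_two_midpoints distortion_midpoints by simp

lemma distortion_gamma_four: "distortion P (gamma_four r P) = r^4 * variance_cantor"
  unfolding gamma_four_midpoints distortion_midpoints by simp

lemma gamma_two_eq: "gamma_two r P = {r / 2, 1 - r / 2}"
  unfolding gamma_two_midpoints words_1 by (auto simp: sim_def)

lemma gamma_four_eq:
  "gamma_four r P = {r\<^sup>2 / 2, r - r\<^sup>2 / 2, 1 - r + r\<^sup>2 / 2, 1 - r\<^sup>2 / 2}"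
  unfolding gamma_four_midpoints words_2 by (auto simp: sim_def power2_eq_square algebra_simps)

text \<open>
  The conditional mean of the cylinders \<open>11\<close> and \<open>121\<close>, the leftmost of the three points.
\<close>

definition outer_mean :: real where
  "outer_mean = (2 * r + r^3) / 6"

lemma gamma_three_eq: "gamma_three r P = {outer_mean, 1/2, 1 - outer_mean}"
proof -
  have rr: "r * r < r - r * r" using mult_strict_left_mono[of r "1/2" r] ratio by simp
  have in_words: "[1, 1] \<in> words 2" "[2, 2] \<in> words 2" "[1, 2, 1] \<in> words 3" "[2, 1, 2] \<in> words 3"
    "[1, 2, 2] \<in> words 3" "[2, 1, 1] \<in> words 3"
    by (auto simp: words_def)
  have "sim_word r [1, 1] 1 = r * r" "sim_word r [1, 2, 1] 0 = r - r * r"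
    "sim_word r [2, 1, 2] 1 = 1 - r + r * r" "sim_word r [2, 2] 0 = 1 - r * r"
    by (simp_all add: sim_def algebra_simps)
  then have "sim_word r [1, 1] 1 < sim_word r [1, 2, 1] 0" "sim_word r [2, 1, 2] 1 < sim_word r [2, 2] 0"
    using rr by linarith+
  then have disj: "J r [1, 1] \<inter> J r [1, 2, 1] = {}" "J r [2, 1, 2] \<inter> J r [2, 2] = {}"
    "J r [1, 2, 2] \<inter> J r [2, 1, 1] = {}"
    using J_disjoint[OF in_words(5,6)] unfolding J_eq by (auto simp del: sim_word.simps)
  have "cmean r P {[1, 1], [1, 2, 1]} = outer_mean"
    "cmean r P {[1, 2, 2], [2, 1, 1]} = 1/2"
    "cmean r P {[2, 1, 2], [2, 2]} = 1 - outer_mean"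
    unfolding cmean_pair[OF in_words(1,3) disj(1)] cmean_pair[OF in_words(4,2) disj(2)]
      cmean_pair[OF in_words(5,6) disj(3)] outer_mean_def
    by (simp_all add: sim_def power2_eq_square power3_eq_cube field_simps)
  then show ?thesis unfolding gamma_three_def by (simp only:)
qed

text \<open>
  If one point serves a whole cylinder, the contribution of the cylinder is its scaled variance plus
  the squared distance from its midpoint to that point.
\<close>

lemma integral_nearest:
  assumes "\<And>y. y \<in> J r w \<Longrightarrow> (MIN b\<in>\<alpha>. (y - b)\<^sup>2) = (y - c)\<^sup>2" "finite \<alpha>" "\<alpha> \<noteq> {}"
  shows "(\<integral>x. (MIN b\<in>\<alpha>. (sim_word r w x - b)\<^sup>2) \<partial>P)
    = r ^ (2 * length w) * variance_cantor + (sim_word r w (1/2) - c)\<^sup>2"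
proof -
  have [measurable]: "(\<lambda>x. MIN b\<in>\<alpha>. (x - b)\<^sup>2) \<in> borel_measurable borel"
    using bounded_measurable_square_distance[OF assms(2,3)] unfolding bounded_measurable_def by blast
  have "(\<integral>x. (MIN b\<in>\<alpha>. (sim_word r w x - b)\<^sup>2) \<partial>P)
      = (\<integral>x. (r ^ length w * x + (sim_word r w 0 - c))\<^sup>2 \<partial>P)"
  proof (rule integral_cong_AE)
    show "(\<lambda>x. MIN b\<in>\<alpha>. (sim_word r w x - b)\<^sup>2) \<in> borel_measurable P"
      using measurable_compose[OF sim_word_measurable, of "\<lambda>x. MIN b\<in>\<alpha>. (x - b)\<^sup>2"] by simp
    show "AE x in P. (MIN b\<in>\<alpha>. (sim_word r w x - b)\<^sup>2) = (r ^ length w * x + (sim_word r w 0 - c))\<^sup>2"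
      using AE_unit
    proof eventually_elim
      case (elim x)
      then have "sim_word r w x \<in> J r w" unfolding J_def by blast
      from assms(1)[OF this] show ?case using sim_word_eq[of r w x] by (simp add: add_diff_eq)
    qed
  qed simp
  also have "\<dots> = (r ^ length w)\<^sup>2 * variance_cantor + (r ^ length w / 2 + (sim_word r w 0 - c))\<^sup>2"
    by (rule expectation_square_affine)
  also have "r ^ length w / 2 + (sim_word r w 0 - c) = sim_word r w (1/2) - c"
    using sim_word_eq[of r w "1/2"] by simp
  finally show ?thesis by (simp add: power_mult[symmetric] mult.commute)
qed

lemma outer_mean_bounds: "0 \<le> outer_mean" "outer_mean \<le> r / 2"
proof -
  have "r^3 \<le> r^1" using ratio by (intro power_decreasing) auto
  then show "0 \<le> outer_mean" "outer_mean \<le> r / 2" unfolding outer_mean_def using ratio by auto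
qed

lemma min_gamma_three:
  shows min_gamma_three_left: "2 * y \<le> outer_mean + 1/2 \<Longrightarrow>
      (MIN b\<in>{outer_mean, 1/2, 1 - outer_mean}. (y - b)\<^sup>2) = (y - outer_mean)\<^sup>2"
    and min_gamma_three_middle: "outer_mean + 1/2 \<le> 2 * y \<Longrightarrow> 2 * y \<le> 3/2 - outer_mean \<Longrightarrow>
      (MIN b\<in>{outer_mean, 1/2, 1 - outer_mean}. (y - b)\<^sup>2) = (y - 1/2)\<^sup>2"
    and min_gamma_three_right: "3/2 - outer_mean \<le> 2 * y \<Longrightarrow>
      (MIN b\<in>{outer_mean, 1/2, 1 - outer_mean}. (y - b)\<^sup>2) = (y - (1 - outer_mean))\<^sup>2"
proof -
  have half: "outer_mean \<le> 1/2" using outer_mean_bounds ratio by linarith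
  have sq: "(y - b)\<^sup>2 \<le> (y - c)\<^sup>2" if "b \<le> c \<and> 2 * y \<le> b + c \<or> c \<le> b \<and> b + c \<le> 2 * y" for b c
    unfolding abs_le_square_iff[symmetric] using that by auto
  show "(MIN b\<in>{outer_mean, 1/2, 1 - outer_mean}. (y - b)\<^sup>2) = (y - outer_mean)\<^sup>2"
    if "2 * y \<le> outer_mean + 1/2"
    using that half by (intro Min_eqI) (auto intro!: sq)
  show "(MIN b\<in>{outer_mean, 1/2, 1 - outer_mean}. (y - b)\<^sup>2) = (y - 1/2)\<^sup>2"
    if "outer_mean + 1/2 \<le> 2 * y" "2 * y \<le> 3/2 - outer_mean"
    using that half by (intro Min_eqI) (auto intro!: sq)
  show "(MIN b\<in>{outer_mean, 1/2, 1 - outer_mean}. (y - b)\<^sup>2) = (y - (1 - outer_mean))\<^sup>2"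
    if "3/2 - outer_mean \<le> 2 * y"
    using that half by (intro Min_eqI) (auto intro!: sq)
qed

text \<open>
  All eight cylinders of level three are served by a single point: \<open>111\<close>, \<open>112\<close>, \<open>121\<close> by the left
  one, \<open>122\<close> and \<open>211\<close> by the middle one, the others by the right one. The critical case is
  the right end \<open>r - r\<^sup>2 + r\<^sup>3\<close> of \<open>121\<close>: it lies to the left of the midpoint between the left and
  the middle point exactly if the cubic is nonpositive. The result is compared with the mean of the
  distortions of the two-point and the four-point set.
\<close>

lemma distortion_gamma_three:
  assumes cubic: "11 * r^3 - 12 * r^2 + 10 * r - 3 \<le> 0" and bounds: "0.43 \<le> r" "r \<le> 0.44"
  shows "distortion P (gamma_three r P) = r^2 * (1 + r^2) * variance_cantor / 2 - advantage_poly r / (48 * (1 + r))"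
proof -
  let ?\<alpha> = "{outer_mean, 1/2, 1 - outer_mean}"
  define b where "b = (outer_mean + 1/2) / 2"
  define c where "c w = (if w \<in> {[1,1,1], [1,1,2], [1,2,1]} then outer_mean
      else if w \<in> {[1,2,2], [2,1,1]} then 1/2 else 1 - outer_mean)" for w :: "nat list"
  define Q where "Q = r * r"
  define R where "R = r * Q"
  have "r^3 \<le> 0.44^3" using bounds by (intro power_mono) auto
  then have r3: "R \<le> 0.0852" by (simp add: R_def Q_def power3_eq_cube)
  have "R < Q" unfolding R_def Q_def using ratio by simp
  moreover have "0 < R" unfolding R_def Q_def using ratio by simp
  moreover have "2 * Q < r" unfolding Q_def using ratio by simp
  moreover have "2 * r < 1" using ratio by simp
  ultimately have order: "R < Q" "0 < R" "2 * Q < r" "2 * r < 1" by blast+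
  have b2: "2 * b = outer_mean + 1/2" unfolding b_def by simp
  have b12: "12 * b = 2 * r + R + 3"
    unfolding b_def outer_mean_def by (simp add: R_def Q_def power3_eq_cube)
  have cubic': "11 * R - 12 * Q + 10 * r - 3 \<le> 0"
    using cubic by (simp add: R_def Q_def power2_eq_square power3_eq_cube mult.assoc)
  \<comment> \<open>The Voronoi boundary \<open>b\<close> lies in the hole between \<open>121\<close> and
      \<open>122\<close>.\<close>
  have cut: "r - Q + R \<le> b" "b \<le> r - R"
    using cubic' r3 bounds b12 by simp_all
  have near: "(MIN a\<in>?\<alpha>. (y - a)\<^sup>2) = (y - c w)\<^sup>2" if w: "w \<in> words 3" and y: "y \<in> J r w" for w y
  proof -
    have ends: "sim_word r w 0 \<le> y" "y \<le> sim_word r w 1" using y unfolding J_eq by auto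
    consider "w \<in> {[1,1,1], [1,1,2], [1,2,1]}" | "w \<in> {[1,2,2], [2,1,1]}"
      | "w \<in> {[2,1,2], [2,2,1], [2,2,2]}"
      using w by (auto simp: words_Suc numeral_3_eq_3)
    then show ?thesis
    proof cases
      case 1
      have "sim_word r [1,1,1] 1 = R" "sim_word r [1,1,2] 1 = Q"
        "sim_word r [1,2,1] 1 = r - Q + R"
        by (simp_all add: R_def Q_def sim_def algebra_simps)
      with 1 ends(2) have "y \<le> R \<or> y \<le> Q \<or> y \<le> r - Q + R" by auto
      then have "2 * y \<le> outer_mean + 1/2" using cut(1) order b2 by linarith
      moreover have "c w = outer_mean" using 1 by (elim insertE emptyE) (simp_all add: c_def)
      ultimately show ?thesis using min_gamma_three_left by (simp only:)
    next
      case 2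
      have "sim_word r [1,2,2] 0 = r - R" "sim_word r [1,2,2] 1 = r"
        "sim_word r [2,1,1] 0 = 1 - r" "sim_word r [2,1,1] 1 = 1 - r + R"
        by (simp_all add: R_def Q_def sim_def algebra_simps)
      with 2 ends have "r - R \<le> y \<and> y \<le> r \<or> 1 - r \<le> y \<and> y \<le> 1 - r + R" by auto
      then have "outer_mean + 1/2 \<le> 2 * y" "2 * y \<le> 3/2 - outer_mean"
        using cut(2) order b2 by linarith+
      moreover have "c w = 1/2" using 2 by (elim insertE emptyE) (simp_all add: c_def)
      ultimately show ?thesis using min_gamma_three_middle by (simp only:)
    next
      case 3
      have "sim_word r [2,1,2] 0 = 1 - r + Q - R" "sim_word r [2,2,1] 0 = 1 - Q"
        "sim_word r [2,2,2] 0 = 1 - R"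
        by (simp_all add: R_def Q_def sim_def algebra_simps)
      with 3 ends(1) have "1 - r + Q - R \<le> y \<or> 1 - Q \<le> y \<or> 1 - R \<le> y" by auto
      then have "3/2 - outer_mean \<le> 2 * y" using cut(1) order b2 by linarith
      moreover have "c w = 1 - outer_mean" using 3 by (elim insertE emptyE) (simp_all add: c_def)
      ultimately show ?thesis using min_gamma_three_right by (simp only:)
    qed
  qed
  have "distortion P ?\<alpha> = (\<Sum>w\<in>words 3. (1/2) ^ 3 * (\<integral>x. (MIN a\<in>?\<alpha>. (sim_word r w x - a)\<^sup>2) \<partial>P))"
    unfolding distortion_def by (intro integral_sim_words bounded_measurable_square_distance) auto
  also have "\<dots> = (\<Sum>w\<in>words 3. 1/8 * (r^6 * variance_cantor + (sim_word r w (1/2) - c w)\<^sup>2))"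
  proof (rule sum.cong[OF refl])
    fix w assume w: "w \<in> words 3"
    then have len: "length w = 3" by (simp add: words_def)
    show "(1/2) ^ 3 * (\<integral>x. (MIN a\<in>?\<alpha>. (sim_word r w x - a)\<^sup>2) \<partial>P)
        = 1/8 * (r^6 * variance_cantor + (sim_word r w (1/2) - c w)\<^sup>2)"
      by (subst integral_nearest[OF near[OF w]]) (auto simp: len power_divide)
  qed
  also have "\<dots> = r^6 * variance_cantor + 1/4 * ((r^3 / 2 - outer_mean)\<^sup>2 + (r^2 - r^3 / 2 - outer_mean)\<^sup>2
      + (r - r^2 + r^3 / 2 - outer_mean)\<^sup>2 + (r - r^3 / 2 - 1/2)\<^sup>2)"
    unfolding numeral_3_eq_3 sum_words_Suc words_0
    by (simp add: c_def sim_def eval_nat_numeral algebra_simps)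
  also have "\<dots> = r^2 * (1 + r^2) * variance_cantor / 2 - advantage_poly r / (48 * (1 + r))"
    unfolding variance_cantor_def outer_mean_def advantage_poly_def using ratio
    by (simp add: divide_simps) (simp add: eval_nat_numeral algebra_simps)
  finally show ?thesis unfolding gamma_three_eq .
qed

section \<open>Comparison of the two families\<close>

lemma beta_set_eq:
  assumes "I \<subseteq> words (ell n)"
  shows "beta_set r P n I = (\<Union>w\<in>I. sim_word r w ` gamma_two r P)
    \<union> (\<Union>w\<in>words (ell n) - I. sim_word r w ` {1/2})"
proof -
  have whole: "(\<lambda>w. cmean r P {w}) ` (words (ell n) - I) = (\<lambda>w. sim_word r w (1/2)) ` (words (ell n) - I)"
    by (intro image_cong refl cmean_single) blast
  have half: "(\<lambda>w. cmean r P {w @ [i]}) ` I = (\<lambda>w. sim_word r w (sim r i (1/2))) ` I" if "i \<in> {1, 2}" for i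
  proof (intro image_cong refl)
    fix w assume "w \<in> I"
    then have "w @ [i] \<in> words (Suc (ell n))" using that assms unfolding words_def by auto
    from cmean_single[OF this] show "cmean r P {w @ [i]} = sim_word r w (sim r i (1/2))"
      by (simp add: sim_word_append)
  qed
  have two: "gamma_two r P = {sim r 1 (1/2), sim r 2 (1/2)}"
    unfolding gamma_two_midpoints words_1 by auto
  have half_1: "(\<lambda>w. cmean r P {w @ [1]}) ` I = (\<lambda>w. sim_word r w (sim r 1 (1/2))) ` I"
    and half_2: "(\<lambda>w. cmean r P {w @ [2]}) ` I = (\<lambda>w. sim_word r w (sim r 2 (1/2))) ` I"
    by (intro half; simp)+
  show ?thesis
    unfolding beta_set_def Setcompr_eq_image whole half_1 half_2 two image_insert image_empty by blast
qed

text \<open>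
  The margin is \<open>r / 2\<close>, attained by the points of a split cylinder. The quadratic is nonnegative
  up to its smaller root, \<open>(5 - sqrt 17) / 2\<close>; beyond this root the end of an unsplit cylinder
  would be closer to the nearest point of a split sibling than to its own midpoint.
\<close>

lemma distortion_beta:
  assumes "I \<subseteq> words (ell n)" and r: "0 \<le> r\<^sup>2 - 5 * r + 2"
  shows "distortion P (beta_set r P n I)
    = (1/2) ^ ell n * r ^ (2 * ell n) * variance_cantor * (real (card I) * r^2 + (2 ^ ell n - real (card I)))"
proof -
  \<comment> \<open>For the singleton, the tile inequality with \<open>a = 1/2\<close> is the quadratic divided
      by \<open>2\<close>.\<close>
  have "tile (r / 2) (gamma_two r P)" "tile (r / 2) {1/2}"
    unfolding gamma_two_eq
    by (rule tileI[of _ _ "r / 2"] tileI[of _ _ "1/2"];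
        use ratio r in \<open>auto simp: power2_eq_square algebra_simps\<close>)+
  then show ?thesis unfolding beta_set_eq[OF assms(1)]
    by (subst distortion_mixture[of "r / 2"])
      (use assms ratio in \<open>auto simp: distortion_gamma_two distortion_half algebra_simps\<close>)
qed

text \<open>
  Even with margin \<open>0\<close> there is room: each of the three sets has a point within \<open>r / 2\<close> of either
  end of the unit interval.
\<close>

lemma tile_gamma:
  assumes "r \<le> 0.44"
  shows "tile 0 (gamma_two r P)" "tile 0 (gamma_three r P)" "tile 0 (gamma_four r P)"
proof -
  have rr: "r * r \<le> 0.44 * 0.44" using assms ratio by (intro mult_mono) auto
  have sq: "0 \<le> r * r" "r * r \<le> r" using ratio by auto
  have cond: "r * a \<le> 1 - 2 * r + r * 0" if "a \<le> r / 2" for a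
  proof -
    have "r * a \<le> r * (r / 2)" using that ratio by (intro mult_left_mono) auto
    then show ?thesis using rr assms by simp
  qed
  show "tile 0 (gamma_two r P)"
    unfolding gamma_two_eq by (rule tileI[of _ _ "r / 2"]) (use ratio cond[of "r / 2"] in auto)
  show "tile 0 (gamma_three r P)"
    unfolding gamma_three_eq
    by (rule tileI[of _ _ outer_mean]) (use ratio outer_mean_bounds cond[of outer_mean] in auto)
  define q where "q = r\<^sup>2"
  have q: "0 \<le> q" "q \<le> r" using sq unfolding q_def power2_eq_square by blast+
  show "tile 0 (gamma_four r P)"
    unfolding gamma_four_eq q_def[symmetric]
    by (rule tileI[of _ _ "q / 2"]) (use ratio q cond[of "q / 2"] in auto)
qed

text \<open>
  Measure everything in cylinders of level \<open>q = ell n - 1\<close>, in units of their mass times squared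
  scale. Replacing two points by three in such a cylinder gains \<open>r\<^sup>2 V - D\<close>, where \<open>V\<close> is the
  variance and \<open>D\<close> the distortion of the three-point set, and replacing three by four gains
  \<open>D - r\<^sup>4 V\<close>. In the first family each additional point gains half of the sum of these, that is
  \<open>r\<^sup>2 V - W\<close>, where \<open>W\<close> is the mean of \<open>r\<^sup>2 V\<close> and \<open>r\<^sup>4 V\<close>. So the two families differ by \<open>W - D\<close>
  for each cylinder of level \<open>q\<close> that receives three points in the second family, and there is
  such a cylinder precisely because \<open>n\<close> is not a power of two.
\<close>

lemma distortion_difference:
  assumes n: "n \<ge> 2" and pow: "\<not> (\<exists>k::nat. k > 0 \<and> n = 2 ^ k)"
    and I: "beta_index n I" and I': "gamma_index n I'"
    and range: "r_zero \<le> r" "r \<le> r_plus"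
  shows "\<exists>c > 0. distortion P (beta_set r P n I) - distortion P (gamma_set r P n I') = c * advantage_poly r"
proof -
  have bounds: "0.43 \<le> r" "r \<le> 0.4377"
    using range r_zero_approx r_plus_approx unfolding abs_less_iff by simp_all
  \<comment> \<open>The number \<open>0.4377\<close> separates \<open>r_plus\<close> from the smaller root of
      the quadratic, which is about \<open>0.4384\<close>.\<close>
  have "0 \<le> (r - 0.4377)\<^sup>2" by simp
  then have r: "0 \<le> r\<^sup>2 - 5 * r + 2" using bounds(2) by (simp add: power2_eq_square algebra_simps)
  define l where "l = ell n"
  have l: "2 ^ l \<le> n" "n < 2 ^ (l + 1)" using ell_bounds[of n] n unfolding l_def by auto
  have "l \<noteq> 0" using l n by (intro notI) auto
  then obtain q where q: "l = Suc q" by (cases l) auto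
  have neq: "n \<noteq> 2 ^ l" using pow \<open>l \<noteq> 0\<close> by (metis neq0_conv)
  define N where "N = n - 2 ^ l"
  have N: "0 < N" "N < 2 * 2 ^ q" "n = N + 2 * 2 ^ q"
    using l neq unfolding N_def q by auto
  have one: "1 \<le> (2::nat) ^ q" by simp
  have Nr: "0 < real N" "real N < 2 * 2 ^ q"
  proof -
    have "real N < real (2 * 2 ^ q)" using N(2) by (simp only: of_nat_less_iff)
    then show "real N < 2 * 2 ^ q" by simp
  qed (use N(1) in simp)
  let ?V = variance_cantor
  let ?D = "distortion P (gamma_three r P)"
  define W where "W = r^2 * (1 + r^2) * ?V / 2"
  define K where "K = (1/2) ^ q * r ^ (2 * q)"
  have K: "0 < K" unfolding K_def using ratio by simp
  have gain: "W - ?D = advantage_poly r / (48 * (1 + r))"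
    using distortion_gamma_three[OF r_plus_cubic_nonpos[OF ratio(1) range(2)]] bounds unfolding W_def by simp
  have beta: "distortion P (beta_set r P n I) = K * (2 ^ q * r^2 * ?V - real N * (r^2 * ?V - W))"
  proof -
    have "I \<subseteq> words (ell n)" "card I = N" using I unfolding beta_index_def N_def l_def by auto
    then have "distortion P (beta_set r P n I)
        = (1/2) ^ Suc q * r ^ (2 * Suc q) * ?V * (real N * r^2 + (2 ^ Suc q - real N))"
      using distortion_beta[of I n] r unfolding l_def[symmetric] q by simp
    also have "\<dots> = K * (2 ^ q * r^2 * ?V - real N * (r^2 * ?V - W))"
      unfolding K_def W_def by (simp add: field_simps power2_eq_square)
    finally show ?thesis .
  qed
  have tiles: "tile 0 (gamma_two r P)" "tile 0 (gamma_three r P)" "tile 0 (gamma_four r P)"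
    using tile_gamma bounds by auto
  have lq: "ell n - 1 = q" using q l_def by simp
  show ?thesis
  proof (cases "n \<le> 3 * 2 ^ q")
    case True
    have "distortion P (gamma_set r P n I') = K * (real N * ?D + (2 ^ q - real N) * (r^2 * ?V))"
    proof (cases "n = 3")
      case n3: True
      have "q = 0"
      proof (rule ccontr)
        assume "q \<noteq> 0"
        then have "(2::nat) \<le> 2 ^ q" by (simp add: self_le_power)
        then show False using N n3 by linarith
      qed
      moreover from this have "N = 1" using N(3) n3 by simp
      ultimately show ?thesis unfolding gamma_set_def K_def using n3 by simp
    next
      case False
      with N(1,3) one have "4 \<le> n" by linarith
      then have sub: "I' \<subseteq> words q" and card: "card I' = N"
        using I' True \<open>4 \<le> n\<close> unfolding gamma_index_def lq N_def l_def by simp_all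
      have "gamma_set r P n I' = (\<Union>w\<in>I'. sim_word r w ` gamma_three r P)
          \<union> (\<Union>w\<in>words q - I'. sim_word r w ` gamma_two r P)"
        using False \<open>4 \<le> n\<close> True unfolding gamma_set_def lq by auto
      then show ?thesis using distortion_mixture[OF tiles(2,1) _ sub] card
        by (simp add: K_def distortion_gamma_two)
    qed
    then have "distortion P (beta_set r P n I) - distortion P (gamma_set r P n I') = K * real N * (W - ?D)"
      unfolding beta by (simp add: algebra_simps)
    then show ?thesis using K Nr ratio unfolding gain
      by (intro exI[of _ "K * real N / (48 * (1 + r))"]) auto
  next
    case False
    with one have n4: "4 \<le> n" by linarith
    have sub: "I' \<subseteq> words q" and card: "card I' = n - 3 * 2 ^ q"
      using I' False n4 unfolding gamma_index_def lq by simp_all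
    have "N = card I' + 2 ^ q" using card N(3) False by linarith
    then have card': "real (card I') = real N - 2 ^ q" by simp
    have "gamma_set r P n I' = (\<Union>w\<in>I'. sim_word r w ` gamma_four r P)
        \<union> (\<Union>w\<in>words q - I'. sim_word r w ` gamma_three r P)"
      using False n4 unfolding gamma_set_def lq by auto
    then have "distortion P (gamma_set r P n I') = K * ((real N - 2 ^ q) * (r^4 * ?V) + (2 * 2 ^ q - real N) * ?D)"
      using distortion_mixture[OF tiles(3,2) _ sub] unfolding card'
      by (simp add: K_def distortion_gamma_four)
    moreover have "r^4 * ?V = 2 * W - r^2 * ?V"
      unfolding W_def by (simp add: algebra_simps eval_nat_numeral)
    then have "2 ^ q * r^2 * ?V - real N * (r^2 * ?V - W)
        = (real N - 2 ^ q) * (r^4 * ?V) + (2 * 2 ^ q - real N) * W"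
      by (simp only:) (simp add: algebra_simps)
    ultimately have "distortion P (beta_set r P n I) - distortion P (gamma_set r P n I')
        = K * (2 * 2 ^ q - real N) * (W - ?D)"
      unfolding beta by (simp only:) (simp add: algebra_simps)
    then show ?thesis using K Nr ratio unfolding gain
      by (intro exI[of _ "K * (2 * 2 ^ q - real N) / (48 * (1 + r))"]) auto
  qed
qed

end

theorem proposition4p1:
  fixes n :: nat and r :: real and P :: "real measure" and I I' :: "nat list set"
  assumes "n \<ge> 2"
    and "\<not> (\<exists>k::nat. k > 0 \<and> n = 2 ^ k)"
    and "0 < r" and "r < 1/2"
    and "cantor_distribution r P"
    and "beta_index n I"
    and "gamma_index n I'"
  shows "r_plus < (5 - sqrt 17) / 2
    \<and> (r_zero < r \<and> r \<le> r_plus \<longrightarrow>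
         distortion P (beta_set r P n I) > distortion P (gamma_set r P n I'))
    \<and> (r = r_zero \<longrightarrow>
         distortion P (beta_set r P n I) = distortion P (gamma_set r P n I'))"
proof -
  interpret prob_space P using assms(5) unfolding cantor_distribution_def by blast
  interpret cantor P r by unfold_locales (fact assms(3-5))+
  have diff: "\<exists>c > 0. distortion P (beta_set r P n I) - distortion P (gamma_set r P n I') = c * advantage_poly r"
    if "r_zero \<le> r" "r \<le> r_plus"
    by (rule distortion_difference) (fact assms that)+
  have "distortion P (gamma_set r P n I') < distortion P (beta_set r P n I)" if "r_zero < r" "r \<le> r_plus"
  proof -
    obtain c where c: "c > 0"
      "distortion P (beta_set r P n I) - distortion P (gamma_set r P n I') = c * advantage_poly r"
      using diff \<open>r_zero < r\<close> \<open>r \<le> r_plus\<close> by auto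
    then have "0 < c * advantage_poly r" using advantage_poly_pos[OF that(1) assms(4)] by simp
    then show ?thesis using c(2) by linarith
  qed
  moreover have "distortion P (beta_set r P n I) = distortion P (gamma_set r P n I')" if "r = r_zero"
  proof -
    have "r_zero \<le> r_plus" using r_zero_approx r_plus_approx unfolding abs_less_iff by simp
    then show ?thesis using diff that r_zero_root(3) by auto
  qed
  ultimately show ?thesis using r_plus_less by blast
qed

end
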